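(* Let $\mathcal{X}\in\mathbb{R}^{I_1\times\cdots\times I_M\times n}$ be a data tensor with frontal slices $\mathcal{X}^{(1)},\dots,\mathcal{X}^{(n)}\in\mathbb{R}^{I_1\times\cdots\times I_M}$, and let $1\le d\le I_1\cdots I_M$. Consider the problem of maximizing $$\Phi_{PCA}(\mathcal{Y})=\sum_{i=1}^n\Big\|\mathcal{Y}^{(i)}-\frac1n\sum_{j=1}^n\mathcal{Y}^{(j)}\Big\|_F^2,\qquad \mathcal{Y}=\mathcal{P}^\top *_M\mathcal{X}\in\mathbb{R}^{d\times n},$$ over all $\mathcal{P}\in\mathbb{R}^{I_1\times\cdots\times I_M\times d}$ with $\mathcal{P}^\top *_M\mathcal{P}=\mathcal{I}$. A solution is given by the tensor $\mathcal{P}$ whose $d$ frontal slices are the largest $d$ left singular tensors of the centered tensor $\mathcal{X}\times_{M+1}H=\mathcal{X}-\mathcal{Q}$, where $H=I_n-\frac1n\mathbf{1}\mathbf{1}^\top$ and $\mathcal{Q}\in\mathbb{R}^{I_1\times\cdots\times I_M\times n}$ has all frontal slices $\mathcal{Q}^{(i)}=\frac1n\sum_j\mathcal{X}^{(j)}$.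
   Context: The frontal slice $\mathcal{A}^{(i)}$ of a tensor is obtained by fixing its last index to $i$. The Einstein product $*_N$ contracts the last $N$ modes of the first tensor with the first $N$ modes of the second: $(\mathcal{A}*_N\mathcal{B})_{i_1\ldots i_p j_1\ldots j_q}=\sum_{k_1,\ldots,k_N}\mathcal{A}_{i_1\ldots i_pk_1\ldots k_N}\mathcal{B}_{k_1\ldots k_Nj_1\ldots j_q}$. For $\mathcal{P}\in\mathbb{R}^{I_1\times\cdots\times I_M\times d}$, the transpose $\mathcal{P}^\top\in\mathbb{R}^{d\times I_1\times\cdots\times I_M}$ has entries $(\mathcal{P}^\top)_{k i_1\ldots i_M}=\mathcal{P}_{i_1\ldots i_M k}$; in general $\mathcal{A}\in\mathbb{R}^{I_1\times\cdots\times I_M\times J_1\times\cdots\times J_N}$ has transpose $(\mathcal{A}^\top)_{j_1\ldots j_Ni_1\ldots i_M}=\mathcal{A}_{i_1\ldots i_Mj_1\ldots j_N}$. $\mathcal{I}$ denotes the identity tensor (here the $d\times d$ identity matrix). $\|\cdot\|_F$ is the Frobenius norm (square root of the sum of squared entries), and $\mathbf 1=(1,\dots,1)^\top\in\mathbb{R}^n$. The $m$-mode product of $\mathcal{A}$ with a matrix $U$ is $(\mathcal{A}\times_mU)_{i_1\ldots i_{m-1}ji_{m+1}\ldots}=\sum_{i_m}U_{ji_m}\mathcal{A}_{i_1\ldots i_m\ldots}$. The Einstein SVD (E-SVD) of $\mathcal{A}\in\mathbb{R}^{I_1\times\cdots\times I_M\times K_1\times\cdots\times K_N}$ is a factorization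 $\mathcal{A}=\mathcal{U}*_M\mathcal{S}*_N\mathcal{V}^\top$ with $\mathcal{U}\in\mathbb{R}^{I_1\times\cdots\times I_M\times I_1\times\cdots\times I_M}$ and $\mathcal{V}\in\mathbb{R}^{K_1\times\cdots\times K_N\times K_1\times\cdots\times K_N}$ unitary ($\mathcal{U}^\top*_M\mathcal{U}=\mathcal{U}*_M\mathcal{U}^\top=\mathcal{I}$, likewise $\mathcal{V}$), and $\mathcal{S}\ge0$ diagonal-like: for each multi-index $(i_1,\ldots,i_M)$ at most one entry $\mathcal{S}_{i_1\ldots i_Mk_1\ldots k_N}$ is nonzero, and likewise for each multi-index $(k_1,\dots,k_N)$. The left singular tensors are the slices $\mathcal{U}_{:\ldots:i_1\ldots i_M}$; the singular value associated with this slice is the nonzero entry among the $\mathcal{S}_{i_1\ldots i_Mk_1\ldots k_N}$, or $0$ if there is none. The "largest $d$" (resp. "smallest $d$") left singular tensors are those associated with the $d$ largest (resp. smallest) singular values, counted with multiplicity. *)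

theory Defs
  imports Complex_Main
begin

section \<open>Real tensors\<close>

text \<open>Indices are counted from 0: a multi-index into a tensor of shape \<open>ds\<close> is a list
  of the same length that is componentwise smaller than \<open>ds\<close>.\<close>

definition idx :: "nat list \<Rightarrow> nat list set" where
  "idx ds = {l. list_all2 (<) l ds}"

text \<open>Entries outside the index range are fixed to 0, so that two tensors of the same shape
  with the same entries are equal.\<close>

typedef tensor = "{(ds :: nat list, f :: nat list \<Rightarrow> real). \<forall>l. l \<notin> idx ds \<longrightarrow> f l = 0}"
  by (rule exI[of _ "([], \<lambda>_. 0)"]) simp

definition dims :: "tensor \<Rightarrow> nat list" where
  "dims A = fst (Rep_tensor A)"

definition entry :: "tensor \<Rightarrow> nat list \<Rightarrow> real" where
  "entry A = snd (Rep_tensor A)"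

definition mk_tensor :: "nat list \<Rightarrow> (nat list \<Rightarrow> real) \<Rightarrow> tensor" where
  "mk_tensor ds f = Abs_tensor (ds, \<lambda>l. if l \<in> idx ds then f l else 0)"

definition tensors :: "nat list \<Rightarrow> tensor set" where
  "tensors ds = {A. dims A = ds}"

abbreviation tensor_order :: "tensor \<Rightarrow> nat" where
  "tensor_order A \<equiv> length (dims A)"

lemma Rep_mk_tensor: "Rep_tensor (mk_tensor ds f) = (ds, \<lambda>l. if l \<in> idx ds then f l else 0)"
  unfolding mk_tensor_def by (rule Abs_tensor_inverse) simp

lemma dims_mk_tensor [simp]: "dims (mk_tensor ds f) = ds"
  by (simp add: dims_def Rep_mk_tensor)

lemma entry_mk_tensor [simp]: "entry (mk_tensor ds f) l = (if l \<in> idx ds then f l else 0)"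
  by (simp add: entry_def Rep_mk_tensor)

lemma entry_outside: "l \<notin> idx (dims A) \<Longrightarrow> entry A l = 0"
  using Rep_tensor[of A] by (auto simp: dims_def entry_def split: prod.splits)

lemma tensor_eqI:
  assumes "dims A = dims B" and "\<And>l. l \<in> idx (dims A) \<Longrightarrow> entry A l = entry B l"
  shows "A = B"
proof -
  have "entry A = entry B"
    using assms entry_outside by (metis ext)
  then have "Rep_tensor A = Rep_tensor B"
    using assms(1) by (simp add: dims_def entry_def prod_eq_iff)
  then show ?thesis
    by (simp add: Rep_tensor_inject)
qed

text \<open>Subtraction is meant for two tensors of the same shape.\<close>

instantiation tensor :: "{minus, scaleR}"
begin

definition minus_tensor :: "tensor \<Rightarrow> tensor \<Rightarrow> tensor" where
  "A - B = mk_tensor (dims A) (\<lambda>l. entry A l - entry B l)"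

definition scaleR_tensor :: "real \<Rightarrow> tensor \<Rightarrow> tensor" where
  "c *\<^sub>R A = mk_tensor (dims A) (\<lambda>l. c * entry A l)"

instance ..

end

text \<open>The Einstein product contracting the last \<open>N\<close> modes of \<open>A\<close> with the first \<open>N\<close> modes
  of \<open>B\<close>; it is meant for \<open>drop (tensor_order A - N) (dims A) = take N (dims B)\<close>.\<close>

definition einstein :: "tensor \<Rightarrow> nat \<Rightarrow> tensor \<Rightarrow> tensor" ("_ \<star>\<^bsub>_\<^esub> _" [71, 0, 72] 71) where
  "A \<star>\<^bsub>N\<^esub> B =
    (let p = tensor_order A - N
     in mk_tensor (take p (dims A) @ drop N (dims B))
          (\<lambda>l. \<Sum>k\<in>idx (drop p (dims A)). entry A (take p l @ k) * entry B (k @ drop p l)))"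

text \<open>The transpose depends on how the modes are split: the first \<open>M\<close> modes are the row modes.\<close>

definition tensor_transpose :: "nat \<Rightarrow> tensor \<Rightarrow> tensor" where
  "tensor_transpose M A =
    (let N = tensor_order A - M
     in mk_tensor (drop M (dims A) @ take M (dims A))
          (\<lambda>l. entry A (drop N l @ take N l)))"

definition id_tensor :: "nat list \<Rightarrow> tensor" where
  "id_tensor ds =
    mk_tensor (ds @ ds) (\<lambda>l. if take (length ds) l = drop (length ds) l then 1 else 0)"

text \<open>Matrices are tensors of order 2. Modes are numbered \<open>1, \<dots>, tensor_order A\<close>.\<close>

definition mode_product :: "tensor \<Rightarrow> nat \<Rightarrow> tensor \<Rightarrow> tensor" where
  "mode_product A m U =
    mk_tensor ((dims A)[m - 1 := dims U ! 0])
      (\<lambda>l. \<Sum>k<dims A ! (m - 1). entry U [l ! (m - 1), k] * entry A (l[m - 1 := k]))"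

definition frobenius_norm :: "tensor \<Rightarrow> real" where
  "frobenius_norm A = sqrt (\<Sum>l\<in>idx (dims A). (entry A l)\<^sup>2)"

text \<open>\<open>slice A js\<close> fixes the last \<open>length js\<close> indices of \<open>A\<close> to \<open>js\<close>.\<close>

definition slice :: "tensor \<Rightarrow> nat list \<Rightarrow> tensor" where
  "slice A js = mk_tensor (take (tensor_order A - length js) (dims A)) (\<lambda>l. entry A (l @ js))"

definition frontal_slice :: "tensor \<Rightarrow> nat \<Rightarrow> tensor" where
  "frontal_slice A i = slice A [i]"

definition mean_slice :: "tensor \<Rightarrow> tensor" where
  "mean_slice A =
    (let n = last (dims A)
     in (1 / real n) *\<^sub>R
          mk_tensor (butlast (dims A)) (\<lambda>l. \<Sum>j<n. entry (frontal_slice A j) l))"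

text \<open>The all-ones vector as an \<open>n \<times> 1\<close> matrix, and
  \<open>H = I - (1/n) 1 1\<^sup>T\<close>.\<close>

definition ones :: "nat \<Rightarrow> tensor" where
  "ones n = mk_tensor [n, 1] (\<lambda>_. 1)"

definition centering_matrix :: "nat \<Rightarrow> tensor" where
  "centering_matrix n =
    id_tensor [n] - (1 / real n) *\<^sub>R (ones n \<star>\<^bsub>1\<^esub> tensor_transpose 1 (ones n))"


section \<open>The Einstein singular value decomposition\<close>

definition unitary :: "nat list \<Rightarrow> tensor \<Rightarrow> bool" where
  "unitary ds U \<longleftrightarrow>
    U \<in> tensors (ds @ ds) \<and>
    tensor_transpose (length ds) U \<star>\<^bsub>length ds\<^esub> U = id_tensor ds \<and>
    U \<star>\<^bsub>length ds\<^esub> tensor_transpose (length ds) U = id_tensor ds"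

definition diagonal_like :: "nat list \<Rightarrow> nat list \<Rightarrow> tensor \<Rightarrow> bool" where
  "diagonal_like Is Ks S \<longleftrightarrow>
    (\<forall>i\<in>idx Is. \<forall>k\<in>idx Ks. \<forall>k'\<in>idx Ks.
        entry S (i @ k) \<noteq> 0 \<and> entry S (i @ k') \<noteq> 0 \<longrightarrow> k = k') \<and>
    (\<forall>k\<in>idx Ks. \<forall>i\<in>idx Is. \<forall>i'\<in>idx Is.
        entry S (i @ k) \<noteq> 0 \<and> entry S (i' @ k) \<noteq> 0 \<longrightarrow> i = i')"

text \<open>The E-SVD of \<open>A\<close> of shape \<open>Is @ Ks\<close>.\<close>

definition is_E_SVD :: "nat list \<Rightarrow> nat list \<Rightarrow> tensor \<Rightarrow> tensor \<Rightarrow> tensor \<Rightarrow> tensor \<Rightarrow> bool" where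
  "is_E_SVD Is Ks A U S V \<longleftrightarrow>
    unitary Is U \<and> unitary Ks V \<and>
    S \<in> tensors (Is @ Ks) \<and> (\<forall>l\<in>idx (Is @ Ks). 0 \<le> entry S l) \<and> diagonal_like Is Ks S \<and>
    A = U \<star>\<^bsub>length Is\<^esub> S \<star>\<^bsub>length Ks\<^esub> tensor_transpose (length Ks) V"

definition singular_value :: "nat list \<Rightarrow> tensor \<Rightarrow> nat list \<Rightarrow> real" where
  "singular_value Ks S i =
    (if \<exists>k\<in>idx Ks. entry S (i @ k) \<noteq> 0
     then entry S (i @ (THE k. k \<in> idx Ks \<and> entry S (i @ k) \<noteq> 0))
     else 0)"

text \<open>The \<open>d\<close> frontal slices of \<open>P\<close> are \<open>d\<close> largest left singular tensors of \<open>A\<close>, for some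
  E-SVD of \<open>A\<close>, some way of breaking ties between equal singular values, and in some order:
  \<open>\<iota>\<close> enumerates the selected multi-indices.\<close>

definition largest_left_singular_tensors ::
    "nat list \<Rightarrow> nat list \<Rightarrow> tensor \<Rightarrow> nat \<Rightarrow> tensor \<Rightarrow> bool" where
  "largest_left_singular_tensors Is Ks A d P \<longleftrightarrow>
    P \<in> tensors (Is @ [d]) \<and>
    (\<exists>U S V \<iota>. is_E_SVD Is Ks A U S V \<and>
      inj_on \<iota> {..<d} \<and> \<iota> ` {..<d} \<subseteq> idx Is \<and>
      (\<forall>i\<in>\<iota> ` {..<d}. \<forall>i'\<in>idx Is - \<iota> ` {..<d}.
          singular_value Ks S i' \<le> singular_value Ks S i) \<and>
      (\<forall>k<d. frontal_slice P k = slice U (\<iota> k)))"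


section \<open>The PCA problem\<close>

definition pca_objective :: "tensor \<Rightarrow> real" where
  "pca_objective Y =
    (\<Sum>i<last (dims Y). (frobenius_norm (frontal_slice Y i - mean_slice Y))\<^sup>2)"

definition pca_feasible :: "nat list \<Rightarrow> nat \<Rightarrow> tensor set" where
  "pca_feasible Is d =
    {P \<in> tensors (Is @ [d]).
       tensor_transpose (length Is) P \<star>\<^bsub>length Is\<^esub> P = id_tensor [d]}"

definition pca_solution :: "nat list \<Rightarrow> nat \<Rightarrow> tensor \<Rightarrow> tensor \<Rightarrow> bool" where
  "pca_solution Is d X P \<longleftrightarrow>
    P \<in> pca_feasible Is d \<and>
    (\<forall>P'\<in>pca_feasible Is d.
       pca_objective (tensor_transpose (length Is) P' \<star>\<^bsub>length Is\<^esub> X)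
         \<le> pca_objective (tensor_transpose (length Is) P \<star>\<^bsub>length Is\<^esub> X))"

end

theory Submission
  imports Defs "HOL-Analysis.Analysis"
begin

text \<open>With the centered tensor \<open>B = X - Q\<close> and an E-SVD of \<open>B\<close>, the objective of a feasible \<open>P\<close>
  is \<open>\<Sum>\<^sub>a \<sigma>\<^sub>a\<^sup>2 w\<^sub>a\<close>, where \<open>w\<^sub>a\<close> is the sum of the squared inner products of the slices of \<open>P\<close> with
  the left singular tensor \<open>U\<^sub>a\<close>. Bessel's inequality gives \<open>0 \<le> w\<^sub>a \<le> 1\<close> and Parseval's identity
  \<open>\<Sum>\<^sub>a w\<^sub>a = d\<close>, so the objective is at most the sum of the \<open>d\<close> largest \<open>\<sigma>\<^sub>a\<^sup>2\<close>, and choosing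
  \<open>d\<close> largest left singular tensors attains this bound.

  For the existence of the E-SVD, maximize \<open>\<Sum>\<^sub>k c\<^sub>k \<langle>u\<^sub>k, A v\<^sub>k\<rangle>\<close> over the compact set of pairs of
  orthonormal bases, for positive pairwise distinct weights \<open>c\<^sub>k\<close>. Rotating two of the \<open>u\<close> or two of
  the \<open>v\<close> shows that \<open>D\<^sub>k\<^sub>l = \<langle>u\<^sub>k, A v\<^sub>l\<rangle>\<close> satisfies \<open>c\<^sub>k D\<^sub>l\<^sub>k = c\<^sub>l D\<^sub>k\<^sub>l\<close> and
  \<open>c\<^sub>k D\<^sub>k\<^sub>l = c\<^sub>l D\<^sub>l\<^sub>k\<close>, hence \<open>D\<^sub>k\<^sub>l = 0\<close> for \<open>k \<noteq> l\<close>; flipping the sign of \<open>u\<^sub>k\<close> shows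
  \<open>D\<^sub>k\<^sub>k \<ge> 0\<close>.\<close>

section \<open>Orthogonal matrices on finite index sets\<close>

text \<open>An orthogonal matrix with the vector index \<open>k\<close> first and the coordinate
  index \<open>i\<close> second. The first relation is orthonormality; the second is completeness,
  on which Parseval's identity and basis expansions rest. Separate index types allow bases numbered
  by naturals over arbitrary coordinates.\<close>

definition orthogonal_family :: "'k set \<Rightarrow> 'a set \<Rightarrow> ('k \<Rightarrow> 'a \<Rightarrow> real) \<Rightarrow> bool" where
  "orthogonal_family K I u \<longleftrightarrow>
    (\<forall>k\<in>K. \<forall>l\<in>K. (\<Sum>i\<in>I. u k i * u l i) = of_bool (k = l)) \<and>
    (\<forall>i\<in>I. \<forall>j\<in>I. (\<Sum>k\<in>K. u k i * u k j) = of_bool (i = j))"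

lemma orthogonal_family_cong:
  assumes "\<And>k i. k \<in> K \<Longrightarrow> i \<in> I \<Longrightarrow> u k i = u' k i"
  shows "orthogonal_family K I u \<longleftrightarrow> orthogonal_family K I u'"
  unfolding orthogonal_family_def using assms by (simp cong: sum.cong)

text \<open>The permutation matrix of \<open>h\<close>; it witnesses that the set to be maximized
  over is nonempty.\<close>

lemma orthogonal_family_bij:
  assumes "finite K" and h: "bij_betw h K I"
  shows "orthogonal_family K I (\<lambda>k i. of_bool (h k = i))"
proof -
  have fin: "finite I" using assms bij_betw_finite by blast
  have 1: "(\<Sum>i\<in>I. of_bool (h k = i) * of_bool (h l = i)) = (of_bool (k = l) :: real)"
    if "k \<in> K" "l \<in> K" for k l
  proof -
    have "(\<Sum>i\<in>I. of_bool (h k = i) * of_bool (h l = i)) = (\<Sum>i\<in>I. if h k = i then of_bool (h l = h k) else (0::real))"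
      by (intro sum.cong) auto
    also have "\<dots> = of_bool (h l = h k)"
      using fin h that by (simp add: bij_betw_apply)
    finally show ?thesis using h that by (auto simp: bij_betw_def inj_on_def)
  qed
  have 2: "(\<Sum>k\<in>K. of_bool (h k = i) * of_bool (h k = j)) = (of_bool (i = j) :: real)"
    if "i \<in> I" "j \<in> I" for i j
  proof -
    have "(\<Sum>k\<in>K. of_bool (h k = i) * of_bool (h k = j)) = (\<Sum>k\<in>I. of_bool (k = i) * of_bool (k = j) :: real)"
      by (rule sum.reindex_bij_betw[OF h, of "\<lambda>k. of_bool (k = i) * of_bool (k = j)"])
    also have "\<dots> = (\<Sum>k\<in>I. if k = i then of_bool (i = j) else 0)"
      by (intro sum.cong) auto
    finally show ?thesis using fin that by simp
  qed
  show ?thesis unfolding orthogonal_family_def using 1 2 by blast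
qed

text \<open>The squares in each column add up to 1. This confines the relevant entries to a compact
  box.\<close>

lemma orthogonal_family_bound:
  assumes "orthogonal_family K I u" "finite K" "k \<in> K" "i \<in> I"
  shows "\<bar>u k i\<bar> \<le> 1"
proof -
  have "(u k i)\<^sup>2 \<le> (\<Sum>k\<in>K. (u k i)\<^sup>2)"
    using assms by (intro member_le_sum) auto
  also have "\<dots> = 1"
    using assms unfolding orthogonal_family_def power2_eq_square by simp
  finally show ?thesis by (simp add: abs_square_le_1)
qed

text \<open>A plane rotation of two of the vectors is multiplication by an orthogonal matrix. It is
  the variation that will test maximality.\<close>

lemma orthogonal_family_rotate:
  assumes u: "orthogonal_family K I u" and "finite K" and pq: "p \<in> K" "q \<in> K" "p \<noteq> q"
    and cs: "c\<^sup>2 + s\<^sup>2 = 1"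
  shows "orthogonal_family K I
    (u(p := \<lambda>i. c * u p i + s * u q i, q := \<lambda>i. c * u q i - s * u p i))"
    (is "orthogonal_family K I ?u")
proof -
  have row: "\<And>k l. k \<in> K \<Longrightarrow> l \<in> K \<Longrightarrow> (\<Sum>i\<in>I. u k i * u l i) = of_bool (k = l)"
    and col: "\<And>i j. i \<in> I \<Longrightarrow> j \<in> I \<Longrightarrow> (\<Sum>k\<in>K. u k i * u k j) = of_bool (i = j)"
    using u by (auto simp: orthogonal_family_def)
  have lin: "(\<Sum>i\<in>I. (a * x i + b * y i) * z i) = a * (\<Sum>i\<in>I. x i * z i) + b * (\<Sum>i\<in>I. y i * z i)"
    for a b :: real and x y z
    by (simp add: sum_distrib_left sum.distrib algebra_simps)
  have lin': "(\<Sum>i\<in>I. z i * (a * x i + b * y i)) = a * (\<Sum>i\<in>I. z i * x i) + b * (\<Sum>i\<in>I. z i * y i)"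
    for a b :: real and x y z
    by (simp add: sum_distrib_left sum.distrib algebra_simps)
  \<comment> \<open>One formula for all three cases \<open>k = p\<close>, \<open>k = q\<close> and
    neither, so that bilinearity expands every inner product at once.\<close>
  have u_eq: "?u k = (\<lambda>i. (if k = p then c else if k = q then - s else 1) * u (if k = q then p else k) i
      + (if k = p then s else if k = q then c else 0) * u q i)" for k
    using pq by auto
  have 1: "(\<Sum>i\<in>I. ?u k i * ?u l i) = of_bool (k = l)" if "k \<in> K" "l \<in> K" for k l
    unfolding u_eq lin lin' using that pq cs
    by (auto simp: row power2_eq_square algebra_simps)
  have 2: "(\<Sum>k\<in>K. ?u k i * ?u k j) = of_bool (i = j)" if ij: "i \<in> I" "j \<in> I" for i j
  proof -
    have split: "sum g K = g p + (g q + sum g (K - {p} - {q}))" for g :: "_ \<Rightarrow> real"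
      using pq assms(2) by (simp add: sum.remove[of K p] sum.remove[of "K - {p}" q])
    \<comment> \<open>In a column only the terms at \<open>p\<close> and \<open>q\<close> change,
      and the rotation preserves their sum.\<close>
    have "?u p i * ?u p j + ?u q i * ?u q j = (c\<^sup>2 + s\<^sup>2) * (u p i * u p j + u q i * u q j)"
      using pq by (simp add: power2_eq_square algebra_simps)
    moreover have "(\<Sum>k\<in>K - {p} - {q}. ?u k i * ?u k j) = (\<Sum>k\<in>K - {p} - {q}. u k i * u k j)"
      by (intro sum.cong) auto
    ultimately have "(\<Sum>k\<in>K. ?u k i * ?u k j) = (\<Sum>k\<in>K. u k i * u k j)"
      using cs by (simp only: split) simp
    then show ?thesis using col ij by simp
  qed
  show ?thesis unfolding orthogonal_family_def using 1 2 by blast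
qed

lemma orthogonal_family_flip:
  assumes u: "orthogonal_family K I u"
  shows "orthogonal_family K I (u(p := \<lambda>i. - u p i))"
proof -
  have e: "u(p := \<lambda>i. - u p i) = (\<lambda>k i. (if k = p then - 1 else 1) * u k i)"
    by auto
  have 1: "(\<Sum>i\<in>I. ((if k = p then - 1 else 1) * u k i) * ((if l = p then - 1 else 1) * u l i)) =
    (if k = p then - 1 else 1) * (if l = p then - 1 else 1) * (\<Sum>i\<in>I. u k i * u l i)" for k l
    by (simp add: sum_negf)
  have 2: "(\<Sum>k\<in>K. ((if k = p then - 1 else 1) * u k i) * ((if k = p then - 1 else 1) * u k j)) =
     (\<Sum>k\<in>K. u k i * u k j)" for i j
    by (intro sum.cong) auto
  show ?thesis
    using u unfolding e orthogonal_family_def 1 2 by auto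
qed

text \<open>At the unit vector \<open>(a / r, b / r)\<close> the linear form has the value
  \<open>r = sqrt (a\<^sup>2 + b\<^sup>2)\<close>, and \<open>r \<le> a\<close> leaves only
  \<open>b = 0\<close>. This is the first-order condition at the point (1, 0) of the circle, without
  derivatives.\<close>

lemma linear_max_on_circle:
  fixes a b :: real
  assumes "\<And>c s. c\<^sup>2 + s\<^sup>2 = 1 \<Longrightarrow> c * a + s * b \<le> a"
  shows "b = 0"
proof (rule ccontr)
  assume b: "b \<noteq> 0"
  define r where "r = sqrt (a\<^sup>2 + b\<^sup>2)"
  have r: "r > 0" "r\<^sup>2 = a\<^sup>2 + b\<^sup>2"
    using b by (simp_all add: r_def sum_power2_gt_zero_iff)
  have "(a / r)\<^sup>2 + (b / r)\<^sup>2 = 1"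
    using r b by (simp add: power_divide flip: add_divide_distrib)
  then have "a / r * a + b / r * b \<le> a" by (rule assms)
  moreover have "a / r * a + b / r * b = r"
    using r by (simp add: field_simps power2_eq_square)
  ultimately have "r \<le> a" by simp
  then have "r\<^sup>2 \<le> a\<^sup>2" using r(1) by (intro power_mono) auto
  with r(2) b show False by simp
qed

text \<open>The objective is linear in each vector, so a sign flip and a plane rotation, which keep
  the family orthogonal, yield the two conditions. The summation range \<open>N\<close> may exceed
  \<open>K\<close>, so that one objective serves two families of different size.\<close>

lemma maximal_family_stationary:
  fixes w :: "'k \<Rightarrow> real" and g :: "'k \<Rightarrow> 'a \<Rightarrow> real"
  assumes u: "orthogonal_family K I u" and fin: "finite K" "finite N" and KN: "K \<subseteq> N"
    and max: "\<And>u'. orthogonal_family K I u' \<Longrightarrow>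
      (\<Sum>k\<in>N. w k * (\<Sum>i\<in>I. u' k i * g k i)) \<le> (\<Sum>k\<in>N. w k * (\<Sum>i\<in>I. u k i * g k i))"
    and p: "p \<in> K"
  shows "0 \<le> w p * (\<Sum>i\<in>I. u p i * g p i)"
    and "\<lbrakk>q \<in> K; p \<noteq> q\<rbrakk> \<Longrightarrow> w p * (\<Sum>i\<in>I. u q i * g p i) = w q * (\<Sum>i\<in>I. u p i * g q i)"
proof -
  let ?F = "\<lambda>u k. w k * (\<Sum>i\<in>I. u k i * g k i)"
  let ?u = "u(p := \<lambda>i. - u p i)"
  have split: "sum f N = f p + sum f (N - {p})" for f :: "_ \<Rightarrow> real"
    using p KN fin by (simp add: sum.remove[of N p] subset_iff)
  have "sum (?F ?u) N \<le> sum (?F u) N" using max orthogonal_family_flip[OF u] .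
  moreover have "sum (?F ?u) (N - {p}) = sum (?F u) (N - {p})" by (intro sum.cong) auto
  ultimately show "0 \<le> w p * (\<Sum>i\<in>I. u p i * g p i)"
    unfolding split by (simp add: sum_negf)
next
  assume q: "q \<in> K" "p \<noteq> q"
  let ?F = "\<lambda>u k. w k * (\<Sum>i\<in>I. u k i * g k i)"
  \<comment> \<open>After the rotation the two affected terms add up to
    \<open>c * ?a + s * ?b\<close>; before it they add up to \<open>?a\<close>.\<close>
  let ?a = "w p * (\<Sum>i\<in>I. u p i * g p i) + w q * (\<Sum>i\<in>I. u q i * g q i)"
  let ?b = "w p * (\<Sum>i\<in>I. u q i * g p i) - w q * (\<Sum>i\<in>I. u p i * g q i)"
  have "c * ?a + s * ?b \<le> ?a" if cs: "c\<^sup>2 + s\<^sup>2 = 1" for c s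
  proof -
    let ?u = "u(p := \<lambda>i. c * u p i + s * u q i, q := \<lambda>i. c * u q i - s * u p i)"
    have split: "sum f N = f p + (f q + sum f (N - {p} - {q}))" for f :: "_ \<Rightarrow> real"
      using p q KN fin by (simp add: sum.remove[of N p] sum.remove[of "N - {p}" q] subset_iff)
    have "sum (?F ?u) N \<le> sum (?F u) N"
      using max orthogonal_family_rotate[OF u fin(1) p q cs] .
    moreover have "sum (?F ?u) (N - {p} - {q}) = sum (?F u) (N - {p} - {q})"
      by (intro sum.cong) auto
    ultimately have "?F ?u p + ?F ?u q \<le> ?F u p + ?F u q"
      unfolding split by linarith
    moreover have "?F ?u p = c * (w p * (\<Sum>i\<in>I. u p i * g p i)) + s * (w p * (\<Sum>i\<in>I. u q i * g p i))"
      using q by (simp add: sum_distrib_left sum.distrib algebra_simps)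
    moreover have "?F ?u q = c * (w q * (\<Sum>i\<in>I. u q i * g q i)) - s * (w q * (\<Sum>i\<in>I. u p i * g q i))"
      using q by (simp add: sum_distrib_left sum.distrib sum_subtractf algebra_simps)
    ultimately show ?thesis by (simp add: algebra_simps)
  qed
  then have "?b = 0" by (rule linear_max_on_circle)
  then show "w p * (\<Sum>i\<in>I. u q i * g p i) = w q * (\<Sum>i\<in>I. u p i * g q i)" by simp
qed

section \<open>Singular value decomposition\<close>

lemma continuous_on_coordinate2:
  "continuous_on S (\<lambda>u :: 'k \<Rightarrow> 'a \<Rightarrow> 'b :: topological_space. u k i)"
proof -
  have "continuous_on S (\<lambda>u :: 'k \<Rightarrow> 'a \<Rightarrow> 'b. u k)"
    by (rule continuous_on_product_then_coordinatewise) (rule continuous_on_id)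
  then show ?thesis by (rule continuous_on_product_then_coordinatewise)
qed

text \<open>Tychonoff's theorem, applied once for each of the two arguments.\<close>

lemma compact_box2: "compact {u :: 'k \<Rightarrow> 'a \<Rightarrow> real. \<forall>k i. u k i \<in> {-1..1}}"
proof -
  have pi: "compact (Pi\<^sub>E UNIV T)" if "\<And>k. compact (T k)" for T :: "'c \<Rightarrow> 'b :: topological_space set"
    using that compactin_PiE[of "\<lambda>_. euclidean" UNIV T]
    by (simp add: euclidean_product_topology)
  have "{u :: 'k \<Rightarrow> 'a \<Rightarrow> real. \<forall>k i. u k i \<in> {-1..1}} = Pi\<^sub>E UNIV (\<lambda>k. Pi\<^sub>E UNIV (\<lambda>i. {-1..1}))"
    by (auto simp: PiE_iff)
  then show ?thesis by (simp add: pi)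
qed

text \<open>The bound is imposed at all arguments, including those outside \<open>K\<close> and
  \<open>I\<close>, where orthogonality says nothing and compactness would otherwise be
  lost.\<close>

definition orthogonal_box :: "'k set \<Rightarrow> 'a set \<Rightarrow> ('k \<Rightarrow> 'a \<Rightarrow> real) set" where
  "orthogonal_box K I = {u. orthogonal_family K I u \<and> (\<forall>k i. u k i \<in> {-1..1})}"

text \<open>Polynomial equations in the coordinates cut a closed subset out of the compact
  box.\<close>

lemma compact_orthogonal_box:
  fixes K :: "'k set" and I :: "'a set"
  assumes "finite K" "finite I"
  shows "compact (orthogonal_box K I)"
proof -
  have "closed {u. orthogonal_family K I u}"
  proof -
    have "{u. orthogonal_family K I u} =
      (\<Inter>k\<in>K. \<Inter>l\<in>K. {u. (\<Sum>i\<in>I. u k i * u l i) = of_bool (k = l)}) \<inter>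
      (\<Inter>i\<in>I. \<Inter>j\<in>I. {u. (\<Sum>k\<in>K. u k i * u k j) = of_bool (i = j)})"
      unfolding orthogonal_family_def by auto
    moreover have "closed {u. (\<Sum>i\<in>I. u k i * u l i) = (of_bool (k = l) :: real)}" for k l :: 'k
      by (intro closed_Collect_eq continuous_intros continuous_on_coordinate2)
    moreover have "closed {u. (\<Sum>k\<in>K. u k i * u k j) = (of_bool (i = j) :: real)}" for i j :: 'a
      by (intro closed_Collect_eq continuous_intros continuous_on_coordinate2)
    ultimately show ?thesis
      by (metis (no_types, lifting) closed_INT closed_Int)
  qed
  then have "compact ({u. \<forall>k i. u k i \<in> {-1..1}} \<inter> {u. orthogonal_family K I u})"
    using compact_box2 by (rule compact_Int_closed[rotated])
  then show ?thesis by (simp add: orthogonal_box_def Int_def conj_commute)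
qed

lemma orthogonal_box_nonempty:
  assumes "finite I"
  shows "orthogonal_box {..<card I} I \<noteq> {}"
proof -
  obtain h where "bij_betw h {..<card I} I"
    using assms ex_bij_betw_nat_finite atLeast0LessThan by metis
  then have "(\<lambda>k i. of_bool (h k = i)) \<in> orthogonal_box {..<card I} I"
    using orthogonal_family_bij[of "{..<card I}" h I] by (simp add: orthogonal_box_def)
  then show ?thesis by blast
qed

text \<open>Setting the irrelevant entries to 0 moves a family into the box; hence a maximum over
  the box is one over all orthogonal families.\<close>

lemma orthogonal_family_truncate:
  assumes "orthogonal_family K I u" "finite K"
  shows "\<exists>u'\<in>orthogonal_box K I. \<forall>k\<in>K. \<forall>i\<in>I. u' k i = u k i"
proof -
  let ?u = "\<lambda>k i. if k \<in> K \<and> i \<in> I then u k i else 0"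
  have "orthogonal_family K I ?u"
    using assms by (subst orthogonal_family_cong[where u' = u]) auto
  moreover have "\<bar>?u k i\<bar> \<le> 1" for k i
    using orthogonal_family_bound[OF assms] by auto
  ultimately have "?u \<in> orthogonal_box K I"
    unfolding orthogonal_box_def by (simp only: abs_le_iff mem_Collect_eq atLeastAtMost_iff) (simp add: minus_le_iff)
  then show ?thesis by (rule rev_bexI) simp
qed

text \<open>A continuous function attains its maximum on the product of two compact boxes. The
  weights vanish off the indices common to both families, so truncating the families does not change
  the objective.\<close>

lemma exists_maximal_orthogonal_pair:
  fixes A :: "'a \<Rightarrow> 'b \<Rightarrow> real" and w :: "nat \<Rightarrow> real"
  assumes fin: "finite I" "finite J" and w: "\<And>k. k \<in> N \<Longrightarrow> w k \<noteq> 0 \<Longrightarrow> k < card I \<and> k < card J"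
  defines "F \<equiv> \<lambda>u v. \<Sum>k\<in>N. w k * (\<Sum>i\<in>I. u k i * (\<Sum>j\<in>J. A i j * v k j))"
  obtains u v where "orthogonal_family {..<card I} I u" "orthogonal_family {..<card J} J v"
    "\<And>u' v'. orthogonal_family {..<card I} I u' \<Longrightarrow> orthogonal_family {..<card J} J v' \<Longrightarrow>
       F u' v' \<le> F u v"
proof -
  let ?m = "{..<card I}" and ?n = "{..<card J}"
  have "compact (orthogonal_box ?m I \<times> orthogonal_box ?n J)"
    using fin by (intro compact_Times compact_orthogonal_box) auto
  moreover have "orthogonal_box ?m I \<times> orthogonal_box ?n J \<noteq> {}"
    using fin by (simp add: orthogonal_box_nonempty)
  moreover have "continuous_on (orthogonal_box ?m I \<times> orthogonal_box ?n J) (\<lambda>x. F (fst x) (snd x))"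
  proof -
    have 1: "continuous_on S (\<lambda>x :: (nat \<Rightarrow> 'a \<Rightarrow> real) \<times> (nat \<Rightarrow> 'b \<Rightarrow> real). fst x k i)" for S k i
      by (rule continuous_on_compose2[OF continuous_on_coordinate2 continuous_on_fst[OF continuous_on_id]]) auto
    have 2: "continuous_on S (\<lambda>x :: (nat \<Rightarrow> 'a \<Rightarrow> real) \<times> (nat \<Rightarrow> 'b \<Rightarrow> real). snd x k i)" for S k i
      by (rule continuous_on_compose2[OF continuous_on_coordinate2 continuous_on_snd[OF continuous_on_id]]) auto
    show ?thesis
      unfolding F_def by (intro continuous_intros 1 2)
  qed
  ultimately obtain x where x: "x \<in> orthogonal_box ?m I \<times> orthogonal_box ?n J"
    and max: "\<forall>y\<in>orthogonal_box ?m I \<times> orthogonal_box ?n J. F (fst y) (snd y) \<le> F (fst x) (snd x)"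
    using continuous_attains_sup by meson
  show ?thesis
  proof
    show "orthogonal_family ?m I (fst x)" "orthogonal_family ?n J (snd x)"
      using x by (auto simp: orthogonal_box_def)
  next
    fix u' v' assume "orthogonal_family ?m I u'" "orthogonal_family ?n J v'"
    obtain u where u: "u \<in> orthogonal_box ?m I" "\<forall>k\<in>?m. \<forall>i\<in>I. u k i = u' k i"
      using orthogonal_family_truncate[OF \<open>orthogonal_family ?m I u'\<close>] by blast
    obtain v where v: "v \<in> orthogonal_box ?n J" "\<forall>k\<in>?n. \<forall>i\<in>J. v k i = v' k i"
      using orthogonal_family_truncate[OF \<open>orthogonal_family ?n J v'\<close>] by blast
    have "w k * (\<Sum>i\<in>I. u' k i * (\<Sum>j\<in>J. A i j * v' k j)) = w k * (\<Sum>i\<in>I. u k i * (\<Sum>j\<in>J. A i j * v k j))"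
      if "k \<in> N" for k
      using w[OF that] u(2) v(2) by (cases "w k = 0") (simp_all cong: sum.cong)
    then have "F u' v' = F u v"
      unfolding F_def by (intro sum.cong refl)
    then show "F u' v' \<le> F (fst x) (snd x)"
      using max u(1) v(1) by auto
  qed
qed

lemma exists_diagonalizing_pair:
  fixes A :: "'a \<Rightarrow> 'b \<Rightarrow> real"
  assumes fin: "finite I" "finite J"
  obtains u v where "orthogonal_family {..<card I} I u" "orthogonal_family {..<card J} J v"
    "\<And>k l. k < card I \<Longrightarrow> l < card J \<Longrightarrow> k \<noteq> l \<Longrightarrow> (\<Sum>i\<in>I. \<Sum>j\<in>J. u k i * A i j * v l j) = 0"
    "\<And>k. k < card I \<Longrightarrow> k < card J \<Longrightarrow> 0 \<le> (\<Sum>i\<in>I. \<Sum>j\<in>J. u k i * A i j * v k j)"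
proof -
  let ?m = "card I" and ?n = "card J"
  define N where "N = {..<max ?m ?n}"
  \<comment> \<open>Positive and pairwise distinct on the common index range, 0 beyond it; the zeros
    take care of rectangular \<open>A\<close>.\<close>
  define w :: "nat \<Rightarrow> real" where "w k = (if k < ?m \<and> k < ?n then 1 / (1 + real k) else 0)" for k
  have w: "k < ?m \<and> k < ?n" if "k \<in> N" "w k \<noteq> 0" for k
    using that by (simp add: w_def split: if_splits)
  let ?F = "\<lambda>u v. \<Sum>k\<in>N. w k * (\<Sum>i\<in>I. u k i * (\<Sum>j\<in>J. A i j * v k j))"
  obtain u v where u: "orthogonal_family {..<?m} I u" and v: "orthogonal_family {..<?n} J v"
    and max: "\<And>u' v'. orthogonal_family {..<?m} I u' \<Longrightarrow> orthogonal_family {..<?n} J v' \<Longrightarrow>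
       ?F u' v' \<le> ?F u v"
    using exists_maximal_orthogonal_pair[where A = A, OF fin w] by blast
  define D where "D k l = (\<Sum>i\<in>I. \<Sum>j\<in>J. u k i * A i j * v l j)" for k l
  have D1: "(\<Sum>i\<in>I. u k i * (\<Sum>j\<in>J. A i j * v l j)) = D k l" for k l
    unfolding D_def by (simp add: sum_distrib_left mult.assoc)
  \<comment> \<open>The same bilinear form, now read as linear in the second family.\<close>
  have swap: "(\<Sum>i\<in>I. u k i * (\<Sum>j\<in>J. A i j * v' l j)) = (\<Sum>j\<in>J. v' l j * (\<Sum>i\<in>I. u k i * A i j))"
    for k l and v' :: "nat \<Rightarrow> 'b \<Rightarrow> real"
    by (simp add: sum_distrib_left algebra_simps) (rule sum.swap)
  have D2: "(\<Sum>j\<in>J. v l j * (\<Sum>i\<in>I. u k i * A i j)) = D k l" for k l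
    using D1 swap by metis
  have sub: "finite N" "{..<?m} \<subseteq> N" "{..<?n} \<subseteq> N"
    by (auto simp: N_def)
  have max_u: "(\<Sum>k\<in>N. w k * (\<Sum>i\<in>I. u' k i * (\<Sum>j\<in>J. A i j * v k j)))
      \<le> (\<Sum>k\<in>N. w k * (\<Sum>i\<in>I. u k i * (\<Sum>j\<in>J. A i j * v k j)))"
    if "orthogonal_family {..<?m} I u'" for u'
    using max[OF that v] .
  have max_v: "(\<Sum>k\<in>N. w k * (\<Sum>j\<in>J. v' k j * (\<Sum>i\<in>I. u k i * A i j)))
      \<le> (\<Sum>k\<in>N. w k * (\<Sum>j\<in>J. v k j * (\<Sum>i\<in>I. u k i * A i j)))"
    if "orthogonal_family {..<?n} J v'" for v'
    using max[OF u that] unfolding swap .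
  \<comment> \<open>With one family fixed, the vectors \<open>g k\<close> are
    \<open>A v\<^sub>k\<close> when \<open>u\<close> varies and \<open>A\<^sup>T u\<^sub>k\<close>
    when \<open>v\<close> varies.\<close>
  note stat_u = maximal_family_stationary[OF u finite_lessThan sub(1,2) max_u, unfolded D1]
  note stat_v = maximal_family_stationary[OF v finite_lessThan sub(1,3) max_v, unfolded D2]
  have eq_u: "w p * D q p = w q * D p q" if "p < ?m" "q < ?m" "p \<noteq> q" for p q
    using stat_u(2) that by simp
  have eq_v: "w p * D p q = w q * D q p" if "p < ?n" "q < ?n" "p \<noteq> q" for p q
    using stat_v(2) that by simp
  have "D k l = 0" if kl: "k < ?m" "l < ?n" "k \<noteq> l" for k l
  proof -
    \<comment> \<open>Either both indices have positive weight, or exactly one of them does; then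
      the zero weight of the other makes a single stationarity relation suffice.\<close>
    consider "l < ?m" "k < ?n" | "\<not> l < ?m" "k < ?n" | "\<not> k < ?n" "l < ?m"
      using kl by linarith
    then show ?thesis
    proof cases
      case 1
      \<comment> \<open>Eliminating \<open>D l k\<close> from the two relations leaves a multiple of
        \<open>D k l\<close> whose factor is nonzero, the weights being positive and
        distinct.\<close>
      have "w k * (w k * D k l) = w k * (w l * D l k)"
        using eq_v[of k l] kl 1 by simp
      also have "\<dots> = w l * (w k * D l k)" by simp
      also have "w k * D l k = w l * D k l"
        using eq_u[of k l] kl 1 by simp
      finally have "((w k)\<^sup>2 - (w l)\<^sup>2) * D k l = 0"
        by (simp add: power2_eq_square algebra_simps)
      moreover have "(w k)\<^sup>2 \<noteq> (w l)\<^sup>2"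
        using kl 1 by (auto simp: w_def power2_eq_iff field_simps)
      ultimately show ?thesis by simp
    next
      case 2
      then show ?thesis using eq_v[of k l] kl by (simp add: w_def)
    next
      case 3
      then show ?thesis using eq_u[of l k] kl by (simp add: w_def)
    qed
  qed
  moreover have "0 \<le> D k k" if "k < ?m" "k < ?n" for k
    using stat_u(1)[of k] that by (simp add: w_def zero_le_divide_iff)
  ultimately show ?thesis
    using that[OF u v] unfolding D_def by blast
qed

section \<open>From diagonalizing bases to the singular value decomposition\<close>

lemma orthogonal_family_reindex:
  assumes u: "orthogonal_family K I u" and h: "bij_betw h L K"
  shows "orthogonal_family L I (\<lambda>l. u (h l))"
proof -
  have "(\<Sum>l\<in>L. u (h l) i * u (h l) j) = (\<Sum>k\<in>K. u k i * u k j)" for i j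
    by (rule sum.reindex_bij_betw[OF h, of "\<lambda>k. u k i * u k j"])
  then show ?thesis
    using u h unfolding orthogonal_family_def
    by (auto simp: bij_betw_def inj_on_eq_iff)
qed

text \<open>Completeness of both bases: with the vectors as rows of \<open>u\<close> and
  \<open>v\<close>, this is \<open>A = u\<^sup>T (u A v\<^sup>T) v\<close>.\<close>

lemma orthogonal_family_expand:
  assumes u: "orthogonal_family K I u" and v: "orthogonal_family L J v"
    and "finite I" "finite J" and i: "i \<in> I" and j: "j \<in> J"
  shows "A i j = (\<Sum>k\<in>K. \<Sum>l\<in>L. u k i * (\<Sum>i'\<in>I. \<Sum>j'\<in>J. u k i' * A i' j' * v l j') * v l j)"
proof -
  have "(\<Sum>k\<in>K. \<Sum>l\<in>L. u k i * (\<Sum>i'\<in>I. \<Sum>j'\<in>J. u k i' * A i' j' * v l j') * v l j)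
      = (\<Sum>k\<in>K. \<Sum>l\<in>L. \<Sum>i'\<in>I. \<Sum>j'\<in>J. A i' j' * (u k i * u k i') * (v l j * v l j'))"
    by (simp add: sum_distrib_left sum_distrib_right algebra_simps)
  also have "\<dots> = (\<Sum>k\<in>K. \<Sum>i'\<in>I. \<Sum>j'\<in>J. \<Sum>l\<in>L. A i' j' * (u k i * u k i') * (v l j * v l j'))"
    by (subst sum.swap[of _ L]) (intro sum.cong refl sum.swap)
  also have "\<dots> = (\<Sum>i'\<in>I. \<Sum>j'\<in>J. \<Sum>k\<in>K. \<Sum>l\<in>L. A i' j' * (u k i * u k i') * (v l j * v l j'))"
    by (subst sum.swap[of _ K]) (intro sum.cong refl sum.swap)
  also have "\<dots> = (\<Sum>i'\<in>I. \<Sum>j'\<in>J. A i' j' * (\<Sum>k\<in>K. u k i * u k i') * (\<Sum>l\<in>L. v l j * v l j'))"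
    by (simp add: sum_distrib_left sum_distrib_right algebra_simps)
  also have "\<dots> = (\<Sum>i'\<in>I. \<Sum>j'\<in>J. if i' = i \<and> j' = j then A i j else 0)"
    using u v i j unfolding orthogonal_family_def by (intro sum.cong refl) auto
  also have "\<dots> = (\<Sum>i'\<in>I. if i' = i then A i j else 0)"
    using assms by (intro sum.cong refl) auto
  also have "\<dots> = A i j"
    using assms by simp
  finally show ?thesis by simp
qed

text \<open>The bases are relabelled by \<open>I\<close> and \<open>J\<close> along enumerations
  \<open>h\<close> and \<open>g\<close>. Then \<open>S i j\<close> can be nonzero only if
  \<open>h i = g j\<close>, and injectivity of \<open>g\<close> and \<open>h\<close> leaves at most
  one nonzero entry per row and column.\<close>

theorem singular_value_decomposition:
  fixes A :: "'a \<Rightarrow> 'b \<Rightarrow> real"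
  assumes fin: "finite I" "finite J"
  obtains u v S where "orthogonal_family I I u" "orthogonal_family J J v"
    "\<And>i j. i \<in> I \<Longrightarrow> j \<in> J \<Longrightarrow> 0 \<le> S i j"
    "\<And>i j j'. \<lbrakk>i \<in> I; j \<in> J; j' \<in> J; S i j \<noteq> 0; S i j' \<noteq> 0\<rbrakk> \<Longrightarrow> j = j'"
    "\<And>i i' j. \<lbrakk>i \<in> I; i' \<in> I; j \<in> J; S i j \<noteq> 0; S i' j \<noteq> 0\<rbrakk> \<Longrightarrow> i = i'"
    "\<And>i j. i \<in> I \<Longrightarrow> j \<in> J \<Longrightarrow> A i j = (\<Sum>k\<in>I. \<Sum>l\<in>J. u k i * S k l * v l j)"
proof -
  obtain u v where u: "orthogonal_family {..<card I} I u" and v: "orthogonal_family {..<card J} J v"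
    and diag: "\<And>k l. k < card I \<Longrightarrow> l < card J \<Longrightarrow> k \<noteq> l \<Longrightarrow> (\<Sum>i\<in>I. \<Sum>j\<in>J. u k i * A i j * v l j) = 0"
    and pos: "\<And>k. k < card I \<Longrightarrow> k < card J \<Longrightarrow> 0 \<le> (\<Sum>i\<in>I. \<Sum>j\<in>J. u k i * A i j * v k j)"
    using exists_diagonalizing_pair[OF fin, of A] by blast
  obtain h where h: "bij_betw h I {..<card I}"
    using ex_bij_betw_finite_nat[OF fin(1)] atLeast0LessThan by metis
  obtain g where g: "bij_betw g J {..<card J}"
    using ex_bij_betw_finite_nat[OF fin(2)] atLeast0LessThan by metis
  define S where "S k l = (\<Sum>i\<in>I. \<Sum>j\<in>J. u (h k) i * A i j * v (g l) j)" for k l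
  have hI: "h i < card I" if "i \<in> I" for i using h that by (auto dest: bij_betw_apply)
  have gJ: "g j < card J" if "j \<in> J" for j using g that by (auto dest: bij_betw_apply)
  have eq: "h i = g j" if "i \<in> I" "j \<in> J" "S i j \<noteq> 0" for i j
    using that diag[OF hI gJ] unfolding S_def by blast
  show ?thesis
  proof (rule that)
    show "orthogonal_family I I (\<lambda>i. u (h i))" "orthogonal_family J J (\<lambda>j. v (g j))"
      using u v h g by (auto intro: orthogonal_family_reindex)
    then show "A i j = (\<Sum>k\<in>I. \<Sum>l\<in>J. u (h k) i * S k l * v (g l) j)" if "i \<in> I" "j \<in> J" for i j
      using orthogonal_family_expand[of I I _ J J _ i j A] that fin unfolding S_def by blast
    show "0 \<le> S i j" if "i \<in> I" "j \<in> J" for i j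
    proof (cases "S i j = 0")
      case False
      then have "h i = g j" using eq that by blast
      then show ?thesis
        using pos[of "h i"] hI[OF that(1)] gJ[OF that(2)] by (simp add: S_def)
    qed simp
    show "j = j'" if "i \<in> I" "j \<in> J" "j' \<in> J" "S i j \<noteq> 0" "S i j' \<noteq> 0" for i j j'
    proof (rule inj_onD[OF bij_betw_imp_inj_on[OF g]])
      show "g j = g j'"
        using eq[OF that(1,2,4)] eq[OF that(1,3,5)] by (rule trans[OF sym])
    qed (rule that)+
    show "i = i'" if "i \<in> I" "i' \<in> I" "j \<in> J" "S i j \<noteq> 0" "S i' j \<noteq> 0" for i i' j
    proof (rule inj_onD[OF bij_betw_imp_inj_on[OF h]])
      show "h i = h i'"
        using eq[OF that(1,3,4)] eq[OF that(2,3,5)] by (rule trans[OF _ sym])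
    qed (rule that)+
  qed
qed

section \<open>Ky Fan's maximum principle\<close>

text \<open>Greedy choice: a maximizer of \<open>f\<close> among the remaining indices is appended.
  It dominates what is left, and so do the earlier choices.\<close>

lemma exists_enumeration_of_largest:
  fixes f :: "'a \<Rightarrow> real"
  assumes "finite I" "d \<le> card I"
  shows "\<exists>\<iota>. inj_on \<iota> {..<d} \<and> \<iota> ` {..<d} \<subseteq> I \<and>
    (\<forall>i\<in>\<iota> ` {..<d}. \<forall>i'\<in>I - \<iota> ` {..<d}. f i' \<le> f i)"
  using assms(2)
proof (induction d)
  case 0
  then show ?case by simp
next
  case (Suc d)
  then have "d \<le> card I" by simp
  from Suc.IH[OF this] obtain \<iota> where \<iota>: "inj_on \<iota> {..<d}" "\<iota> ` {..<d} \<subseteq> I"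
    and max: "\<And>i i'. i \<in> \<iota> ` {..<d} \<Longrightarrow> i' \<in> I - \<iota> ` {..<d} \<Longrightarrow> f i' \<le> f i"
    by blast
  let ?R = "I - \<iota> ` {..<d}"
  have "card (\<iota> ` {..<d}) = d" using \<iota> by (simp add: card_image)
  then have "card ?R > 0"
    using \<iota> assms(1) Suc.prems by (simp add: card_Diff_subset)
  then have "finite ?R" "?R \<noteq> {}" by (auto simp: card_gt_0_iff)
  then have "Max (f ` ?R) \<in> f ` ?R" and ge: "\<And>i. i \<in> ?R \<Longrightarrow> f i \<le> Max (f ` ?R)"
    by (intro Max_in Max_ge; simp)+
  then obtain a where a: "a \<in> ?R" "\<And>i. i \<in> ?R \<Longrightarrow> f i \<le> f a"
    by auto
  let ?\<iota> = "\<iota>(d := a)"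
  have im: "?\<iota> ` {..<Suc d} = insert a (\<iota> ` {..<d})"
    by (auto simp: lessThan_Suc)
  have "inj_on ?\<iota> {..<Suc d}"
    using \<iota>(1) a(1) by (auto simp: lessThan_Suc inj_on_def)
  moreover have "\<forall>i\<in>?\<iota> ` {..<Suc d}. \<forall>i'\<in>I - ?\<iota> ` {..<Suc d}. f i' \<le> f i"
    unfolding im using a max by auto
  ultimately show ?case
    using \<iota>(2) a(1) by (intro exI[of _ ?\<iota>] conjI) (simp_all only: im, blast)
qed

text \<open>The squared distance from \<open>x\<close> to its projection onto the span of the
  \<open>p k\<close> is nonnegative; its cross term and its square term are both expressed by the
  sum of the squared coefficients.\<close>

lemma bessel_inequality:
  fixes p :: "'k \<Rightarrow> 'a \<Rightarrow> real" and x :: "'a \<Rightarrow> real"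
  assumes "finite K"
    and orth: "\<And>k l. k \<in> K \<Longrightarrow> l \<in> K \<Longrightarrow> (\<Sum>i\<in>I. p k i * p l i) = of_bool (k = l)"
  shows "(\<Sum>k\<in>K. (\<Sum>i\<in>I. p k i * x i)\<^sup>2) \<le> (\<Sum>i\<in>I. (x i)\<^sup>2)"
proof -
  define c where "c k = (\<Sum>i\<in>I. p k i * x i)" for k
  have cross: "(\<Sum>i\<in>I. x i * (\<Sum>k\<in>K. c k * p k i)) = (\<Sum>k\<in>K. (c k)\<^sup>2)"
  proof -
    have "(\<Sum>i\<in>I. x i * (\<Sum>k\<in>K. c k * p k i)) = (\<Sum>k\<in>K. \<Sum>i\<in>I. c k * (p k i * x i))"
      by (subst sum.swap) (simp add: sum_distrib_left algebra_simps)
    then show ?thesis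
      unfolding c_def by (simp add: power2_eq_square flip: sum_distrib_left)
  qed
  have square: "(\<Sum>i\<in>I. (\<Sum>k\<in>K. c k * p k i)\<^sup>2) = (\<Sum>k\<in>K. (c k)\<^sup>2)"
  proof -
    have "(\<Sum>i\<in>I. (\<Sum>k\<in>K. c k * p k i)\<^sup>2) = (\<Sum>i\<in>I. \<Sum>k\<in>K. \<Sum>l\<in>K. c k * c l * (p k i * p l i))"
      by (simp add: power2_eq_square sum_product algebra_simps)
    also have "\<dots> = (\<Sum>k\<in>K. \<Sum>l\<in>K. \<Sum>i\<in>I. c k * c l * (p k i * p l i))"
      by (subst sum.swap) (intro sum.cong refl sum.swap)
    also have "\<dots> = (\<Sum>k\<in>K. \<Sum>l\<in>K. if k = l then (c k)\<^sup>2 else 0)"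
      by (intro sum.cong refl) (auto simp: orth power2_eq_square simp flip: sum_distrib_left)
    finally show ?thesis using \<open>finite K\<close> by simp
  qed
  have "0 \<le> (\<Sum>i\<in>I. (x i - (\<Sum>k\<in>K. c k * p k i))\<^sup>2)"
    by (intro sum_nonneg) simp
  also have "\<dots> = (\<Sum>i\<in>I. (x i)\<^sup>2) + (\<Sum>i\<in>I. (\<Sum>k\<in>K. c k * p k i)\<^sup>2) - 2 * (\<Sum>i\<in>I. x i * (\<Sum>k\<in>K. c k * p k i))"
    by (simp add: power2_diff sum.distrib sum_subtractf sum_distrib_left mult.assoc)
  finally have "(\<Sum>k\<in>K. (c k)\<^sup>2) \<le> (\<Sum>i\<in>I. (x i)\<^sup>2)"
    unfolding cross square by simp
  then show ?thesis unfolding c_def .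
qed

text \<open>Expanding the squares, the completeness relation kills all terms with
  \<open>i \<noteq> j\<close>.\<close>

lemma parseval_identity:
  fixes u :: "'k \<Rightarrow> 'a \<Rightarrow> real"
  assumes u: "orthogonal_family K I u" and "finite I"
  shows "(\<Sum>k\<in>K. (\<Sum>i\<in>I. x i * u k i)\<^sup>2) = (\<Sum>i\<in>I. (x i)\<^sup>2)"
proof -
  have "(\<Sum>k\<in>K. (\<Sum>i\<in>I. x i * u k i)\<^sup>2) = (\<Sum>k\<in>K. \<Sum>i\<in>I. \<Sum>j\<in>I. x i * x j * (u k i * u k j))"
    by (simp add: power2_eq_square sum_product algebra_simps)
  also have "\<dots> = (\<Sum>i\<in>I. \<Sum>j\<in>I. \<Sum>k\<in>K. x i * x j * (u k i * u k j))"
    by (subst sum.swap) (intro sum.cong refl sum.swap)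
  also have "\<dots> = (\<Sum>i\<in>I. \<Sum>j\<in>I. if i = j then (x i)\<^sup>2 else 0)"
    using u unfolding orthogonal_family_def
    by (intro sum.cong refl) (auto simp: power2_eq_square simp flip: sum_distrib_left)
  finally show ?thesis using \<open>finite I\<close> by simp
qed

text \<open>Subtract the threshold \<open>\<tau>\<close>, the least value on \<open>T\<close>: terms
  outside \<open>T\<close> become nonpositive, and those inside are largest at weight 1. Since the
  total weight is \<open>card T\<close>, the shift costs both sides the same.\<close>

lemma weighted_sum_le_sum_largest:
  fixes s w :: "'a \<Rightarrow> real"
  assumes fin: "finite I" and T: "T \<subseteq> I"
    and largest: "\<And>i i'. i \<in> T \<Longrightarrow> i' \<in> I - T \<Longrightarrow> s i' \<le> s i"
    and w: "\<And>i. i \<in> I \<Longrightarrow> 0 \<le> w i \<and> w i \<le> 1" and total: "(\<Sum>i\<in>I. w i) = card T"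
  shows "(\<Sum>i\<in>I. s i * w i) \<le> (\<Sum>i\<in>T. s i)"
proof (cases "T = {}")
  \<comment> \<open>An empty \<open>T\<close> has no least value; here the total weight 0 forces
    every weight to be 0.\<close>
  case True
  then have "\<forall>i\<in>I. w i = 0"
    using total w fin by (simp add: sum_nonneg_eq_0_iff)
  then show ?thesis using True by simp
next
  case False
  define \<tau> where "\<tau> = Min (s ` T)"
  have finT: "finite T" using fin T finite_subset by blast
  have \<tau>: "\<tau> \<le> s i" if "i \<in> T" for i
    unfolding \<tau>_def using that finT by simp
  have \<tau>': "s i \<le> \<tau>" if "i \<in> I - T" for i
    using Min_in[of "s ` T"] finT False largest that unfolding \<tau>_def by fastforce
  have split: "sum g I = sum g T + sum g (I - T)" for g :: "'a \<Rightarrow> real"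
    using sum.subset_diff[OF T fin, of g] by simp
  have "(\<Sum>i\<in>I. (s i - \<tau>) * w i) \<le> (\<Sum>i\<in>T. s i - \<tau>)"
  proof -
    have "(\<Sum>i\<in>I - T. (s i - \<tau>) * w i) \<le> 0"
      using \<tau>' w by (intro sum_nonpos mult_nonpos_nonneg) auto
    moreover have "(\<Sum>i\<in>T. (s i - \<tau>) * w i) \<le> (\<Sum>i\<in>T. s i - \<tau>)"
      using \<tau> w T by (intro sum_mono mult_left_le) auto
    ultimately show ?thesis unfolding split by linarith
  qed
  moreover have "(\<Sum>i\<in>I. (s i - \<tau>) * w i) = (\<Sum>i\<in>I. s i * w i) - \<tau> * card T"
    by (simp add: left_diff_distrib sum_subtractf flip: sum_distrib_left total)
  moreover have "(\<Sum>i\<in>T. s i - \<tau>) = (\<Sum>i\<in>T. s i) - \<tau> * card T"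
    by (simp add: sum_subtractf)
  ultimately show ?thesis by simp
qed

text \<open>The left side is the trace of the quadratic form with eigenvectors \<open>u l\<close>
  and eigenvalues \<open>s l\<close>, compressed to the span of the \<open>p k\<close>.\<close>

lemma ky_fan_inequality:
  fixes p :: "'k \<Rightarrow> 'a \<Rightarrow> real" and u :: "'b \<Rightarrow> 'a \<Rightarrow> real"
  assumes fin: "finite K" "finite I" "finite L" and u: "orthogonal_family L I u"
    and orth: "\<And>k l. k \<in> K \<Longrightarrow> l \<in> K \<Longrightarrow> (\<Sum>i\<in>I. p k i * p l i) = of_bool (k = l)"
    and T: "T \<subseteq> L" "card T = card K"
    and largest: "\<And>i i'. i \<in> T \<Longrightarrow> i' \<in> L - T \<Longrightarrow> s i' \<le> s i"
  shows "(\<Sum>k\<in>K. \<Sum>l\<in>L. s l * (\<Sum>i\<in>I. p k i * u l i)\<^sup>2) \<le> (\<Sum>l\<in>T. s l)"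
proof -
  define w where "w l = (\<Sum>k\<in>K. (\<Sum>i\<in>I. p k i * u l i)\<^sup>2)" for l
  have "w l \<le> 1" if "l \<in> L" for l
    using bessel_inequality[OF fin(1) orth, where x = "u l"] u that
    unfolding w_def orthogonal_family_def by (simp add: power2_eq_square)
  moreover have "0 \<le> w l" for l
    unfolding w_def by (intro sum_nonneg) simp
  moreover have "(\<Sum>l\<in>L. w l) = card T"
  proof -
    have "(\<Sum>l\<in>L. w l) = (\<Sum>k\<in>K. \<Sum>i\<in>I. (p k i)\<^sup>2)"
      unfolding w_def by (subst sum.swap) (simp add: parseval_identity[OF u fin(2)])
    also have "\<dots> = (\<Sum>k\<in>K. 1)"
      using orth by (intro sum.cong refl) (simp add: power2_eq_square)
    finally show ?thesis using T(2) by simp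
  qed
  ultimately have "(\<Sum>l\<in>L. s l * w l) \<le> (\<Sum>l\<in>T. s l)"
    using fin(3) T(1) largest by (intro weighted_sum_le_sum_largest) auto
  moreover have "(\<Sum>k\<in>K. \<Sum>l\<in>L. s l * (\<Sum>i\<in>I. p k i * u l i)\<^sup>2) = (\<Sum>l\<in>L. s l * w l)"
    unfolding w_def by (subst sum.swap) (simp add: sum_distrib_left)
  ultimately show ?thesis by simp
qed

section \<open>Tensors\<close>

lemma idx_length: "l \<in> idx ds \<Longrightarrow> length l = length ds"
  by (simp add: idx_def list_all2_lengthD)

lemma append_mem_idx_iff:
  "length a = length as \<Longrightarrow> a @ b \<in> idx (as @ bs) \<longleftrightarrow> a \<in> idx as \<and> b \<in> idx bs"
  by (simp add: idx_def list_all2_append)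

lemma append_mem_idx: "a \<in> idx as \<Longrightarrow> b \<in> idx bs \<Longrightarrow> a @ b \<in> idx (as @ bs)"
  by (simp add: append_mem_idx_iff idx_length)

lemma idx_appendE:
  assumes "l \<in> idx (as @ bs)"
  obtains a b where "l = a @ b" "a \<in> idx as" "b \<in> idx bs"
  using assms by (auto simp: idx_def list_all2_append2)

lemma idx_Nil [simp]: "idx [] = {[]}"
  by (auto simp: idx_def)

lemma idx_Cons: "idx (n # ns) = (\<lambda>(i, l). i # l) ` ({..<n} \<times> idx ns)"
  by (auto simp: idx_def list_all2_Cons2)

lemma idx_singleton: "idx [n] = (\<lambda>i. [i]) ` {..<n}"
  by (auto simp: idx_Cons)

lemma sum_idx_singleton: "(\<Sum>l\<in>idx [n]. f l) = (\<Sum>i<n. f [i])"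
  by (simp add: idx_singleton sum.reindex inj_on_def)

lemma finite_idx [simp]: "finite (idx ds)"
  by (induction ds) (simp_all add: idx_Cons)

lemma card_idx: "card (idx ds) = prod_list ds"
proof (induction ds)
  case (Cons n ns)
  have "inj_on (\<lambda>(i, l). i # l) ({..<n} \<times> idx ns)"
    by (auto simp: inj_on_def)
  then show ?case
    using Cons by (simp add: idx_Cons card_image card_cartesian_product)
qed simp

text \<open>Indices appear split into row and column part, the form in which products and transposes
  are evaluated.\<close>

lemma tensor_eq_iff:
  assumes "A \<in> tensors (as @ bs)" "B \<in> tensors (as @ bs)"
  shows "A = B \<longleftrightarrow> (\<forall>a\<in>idx as. \<forall>b\<in>idx bs. entry A (a @ b) = entry B (a @ b))"
proof
  assume eq: "\<forall>a\<in>idx as. \<forall>b\<in>idx bs. entry A (a @ b) = entry B (a @ b)"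
  have "entry A l = entry B l" if l: "l \<in> idx (dims A)" for l
  proof -
    have "l \<in> idx (as @ bs)"
      using l assms(1) by (simp add: tensors_def)
    then show ?thesis
      using eq by (auto elim: idx_appendE)
  qed
  then show "A = B"
    using assms by (intro tensor_eqI) (simp_all add: tensors_def)
qed simp

section \<open>Shapes and entries of the tensor operations\<close>

lemma einstein_in_tensors:
  assumes "A \<in> tensors (as @ bs)" "B \<in> tensors (bs @ cs)"
  shows "A \<star>\<^bsub>length bs\<^esub> B \<in> tensors (as @ cs)"
  using assms by (simp add: tensors_def einstein_def Let_def)

lemma entry_einstein:
  assumes "A \<in> tensors (as @ bs)" "B \<in> tensors (bs @ cs)" "a \<in> idx as" "c \<in> idx cs"
  shows "entry (A \<star>\<^bsub>length bs\<^esub> B) (a @ c) = (\<Sum>k\<in>idx bs. entry A (a @ k) * entry B (k @ c))"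
  using assms by (simp add: tensors_def einstein_def Let_def append_mem_idx idx_length)

lemma transpose_in_tensors:
  assumes "A \<in> tensors (as @ bs)"
  shows "tensor_transpose (length as) A \<in> tensors (bs @ as)"
  using assms by (simp add: tensors_def tensor_transpose_def Let_def)

lemma entry_transpose:
  assumes "A \<in> tensors (as @ bs)" "a \<in> idx as" "b \<in> idx bs"
  shows "entry (tensor_transpose (length as) A) (b @ a) = entry A (a @ b)"
  using assms by (simp add: tensors_def tensor_transpose_def Let_def append_mem_idx idx_length)

lemma id_tensor_in_tensors: "id_tensor ds \<in> tensors (ds @ ds)"
  by (simp add: tensors_def id_tensor_def)

lemma entry_id_tensor:
  assumes "a \<in> idx ds" "b \<in> idx ds"
  shows "entry (id_tensor ds) (a @ b) = of_bool (a = b)"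
  using assms by (simp add: id_tensor_def append_mem_idx idx_length)

lemma entry_minus: "l \<in> idx (dims A) \<Longrightarrow> entry (A - B) l = entry A l - entry B l"
  by (simp add: minus_tensor_def)

lemma dims_minus [simp]: "dims (A - B) = dims A"
  by (simp add: minus_tensor_def)

lemma entry_scaleR: "entry (c *\<^sub>R A) l = c * entry A l"
  by (simp add: scaleR_tensor_def entry_outside)

lemma dims_scaleR [simp]: "dims (c *\<^sub>R A) = dims A"
  by (simp add: scaleR_tensor_def)

lemma dims_slice:
  assumes "A \<in> tensors (as @ bs)" "length js = length bs"
  shows "dims (slice A js) = as"
  using assms by (simp add: tensors_def slice_def)

lemma entry_slice:
  assumes "A \<in> tensors (as @ bs)" "length js = length bs" "a \<in> idx as"
  shows "entry (slice A js) a = entry A (a @ js)"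
  using assms by (simp add: tensors_def slice_def)

lemma dims_frontal_slice:
  "A \<in> tensors (ds @ [n]) \<Longrightarrow> dims (frontal_slice A i) = ds"
  by (simp add: frontal_slice_def dims_slice)

lemma entry_frontal_slice:
  "A \<in> tensors (ds @ [n]) \<Longrightarrow> l \<in> idx ds \<Longrightarrow> entry (frontal_slice A i) l = entry A (l @ [i])"
  by (simp add: frontal_slice_def entry_slice)

lemma entry_mean_slice:
  assumes "A \<in> tensors (ds @ [n])" "l \<in> idx ds"
  shows "entry (mean_slice A) l = (\<Sum>j<n. entry A (l @ [j])) / n"
proof -
  have "dims A = ds @ [n]" using assms(1) by (simp add: tensors_def)
  then show ?thesis
    using assms(2) by (simp add: mean_slice_def Let_def entry_scaleR entry_frontal_slice[OF assms])
qed

text \<open>The family consists of the slices of \<open>U\<close>, so the family index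
  \<open>a\<close> trails. \<open>U\<^sup>T U\<close> gives orthonormality and
  \<open>U U\<^sup>T\<close> completeness.\<close>

lemma unitary_iff_orthogonal_family:
  assumes "U \<in> tensors (ds @ ds)"
  shows "unitary ds U \<longleftrightarrow> orthogonal_family (idx ds) (idx ds) (\<lambda>a i. entry U (i @ a))"
proof -
  note T = transpose_in_tensors[OF assms]
  have "tensor_transpose (length ds) U \<star>\<^bsub>length ds\<^esub> U = id_tensor ds \<longleftrightarrow>
      (\<forall>a\<in>idx ds. \<forall>b\<in>idx ds. (\<Sum>i\<in>idx ds. entry U (i @ a) * entry U (i @ b)) = of_bool (a = b))"
    using assms T
    by (simp add: tensor_eq_iff[OF einstein_in_tensors id_tensor_in_tensors] entry_einstein entry_id_tensor
        entry_transpose[OF assms] cong: sum.cong)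
  moreover have "U \<star>\<^bsub>length ds\<^esub> tensor_transpose (length ds) U = id_tensor ds \<longleftrightarrow>
      (\<forall>a\<in>idx ds. \<forall>b\<in>idx ds. (\<Sum>i\<in>idx ds. entry U (a @ i) * entry U (b @ i)) = of_bool (a = b))"
    using assms T
    by (simp add: tensor_eq_iff[OF einstein_in_tensors id_tensor_in_tensors] entry_einstein entry_id_tensor
        entry_transpose[OF assms] cong: sum.cong)
  ultimately show ?thesis
    using assms unfolding unitary_def orthogonal_family_def by simp
qed

section \<open>Existence of the E-SVD\<close>

lemma svd_product_in_tensors:
  assumes "U \<in> tensors (Is @ Is)" "S \<in> tensors (Is @ Ks)" "V \<in> tensors (Ks @ Ks)"
  shows "U \<star>\<^bsub>length Is\<^esub> S \<star>\<^bsub>length Ks\<^esub> tensor_transpose (length Ks) V \<in> tensors (Is @ Ks)"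
  using assms by (intro einstein_in_tensors transpose_in_tensors)

lemma entry_svd_product:
  assumes "U \<in> tensors (Is @ Is)" "S \<in> tensors (Is @ Ks)" "V \<in> tensors (Ks @ Ks)"
    and "i \<in> idx Is" "k \<in> idx Ks"
  shows "entry (U \<star>\<^bsub>length Is\<^esub> S \<star>\<^bsub>length Ks\<^esub> tensor_transpose (length Ks) V) (i @ k) =
    (\<Sum>a\<in>idx Is. \<Sum>b\<in>idx Ks. entry U (i @ a) * entry S (a @ b) * entry V (k @ b))"
proof -
  have "entry (U \<star>\<^bsub>length Is\<^esub> S \<star>\<^bsub>length Ks\<^esub> tensor_transpose (length Ks) V) (i @ k) =
    (\<Sum>b\<in>idx Ks. (\<Sum>a\<in>idx Is. entry U (i @ a) * entry S (a @ b)) * entry V (k @ b))"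
    using assms
    by (simp add: entry_einstein[OF einstein_in_tensors[OF assms(1,2)] transpose_in_tensors[OF assms(3)]]
        entry_einstein[OF assms(1,2)] entry_transpose[OF assms(3)])
  then show ?thesis
    by (simp add: sum_distrib_right) (rule sum.swap)
qed

theorem exists_E_SVD:
  assumes A: "A \<in> tensors (Is @ Ks)"
  shows "\<exists>U S V. is_E_SVD Is Ks A U S V"
proof -
  obtain u v s where u: "orthogonal_family (idx Is) (idx Is) u" and v: "orthogonal_family (idx Ks) (idx Ks) v"
    and pos: "\<And>i k. i \<in> idx Is \<Longrightarrow> k \<in> idx Ks \<Longrightarrow> 0 \<le> s i k"
    and diag: "\<And>i k k'. \<lbrakk>i \<in> idx Is; k \<in> idx Ks; k' \<in> idx Ks; s i k \<noteq> 0; s i k' \<noteq> 0\<rbrakk> \<Longrightarrow> k = k'"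
      "\<And>i i' k. \<lbrakk>i \<in> idx Is; i' \<in> idx Is; k \<in> idx Ks; s i k \<noteq> 0; s i' k \<noteq> 0\<rbrakk> \<Longrightarrow> i = i'"
    and eq: "\<And>i k. i \<in> idx Is \<Longrightarrow> k \<in> idx Ks \<Longrightarrow>
      entry A (i @ k) = (\<Sum>a\<in>idx Is. \<Sum>b\<in>idx Ks. u a i * s a b * v b k)"
    using singular_value_decomposition[of "idx Is" "idx Ks" "\<lambda>i k. entry A (i @ k)"]
    by (smt (verit) finite_idx)
  \<comment> \<open>The family index comes first in \<open>u\<close> but last in the tensor, hence
    \<open>drop\<close> before \<open>take\<close>.\<close>
  let ?U = "mk_tensor (Is @ Is) (\<lambda>l. u (drop (length Is) l) (take (length Is) l))"
  let ?V = "mk_tensor (Ks @ Ks) (\<lambda>l. v (drop (length Ks) l) (take (length Ks) l))"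
  let ?S = "mk_tensor (Is @ Ks) (\<lambda>l. s (take (length Is) l) (drop (length Is) l))"
  have mem: "?U \<in> tensors (Is @ Is)" "?S \<in> tensors (Is @ Ks)" "?V \<in> tensors (Ks @ Ks)"
    by (simp_all add: tensors_def)
  have U: "entry ?U (i @ a) = u a i" if "i \<in> idx Is" "a \<in> idx Is" for i a
    using that by (simp add: append_mem_idx idx_length)
  have V: "entry ?V (i @ a) = v a i" if "i \<in> idx Ks" "a \<in> idx Ks" for i a
    using that by (simp add: append_mem_idx idx_length)
  have S: "entry ?S (i @ a) = s i a" if "i \<in> idx Is" "a \<in> idx Ks" for i a
    using that by (simp add: append_mem_idx idx_length)
  have "unitary Is ?U"
    unfolding unitary_iff_orthogonal_family[OF mem(1)]
    by (rule orthogonal_family_cong[THEN iffD2, OF _ u]) (rule U)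
  moreover have "unitary Ks ?V"
    unfolding unitary_iff_orthogonal_family[OF mem(3)]
    by (rule orthogonal_family_cong[THEN iffD2, OF _ v]) (rule V)
  moreover have "diagonal_like Is Ks ?S"
    unfolding diagonal_like_def using diag by (auto simp: S simp del: entry_mk_tensor)
  moreover have "\<forall>l\<in>idx (Is @ Ks). 0 \<le> entry ?S l"
    using pos by (auto simp: S simp del: entry_mk_tensor elim!: idx_appendE)
  moreover have "A = ?U \<star>\<^bsub>length Is\<^esub> ?S \<star>\<^bsub>length Ks\<^esub> tensor_transpose (length Ks) ?V"
    unfolding tensor_eq_iff[OF A svd_product_in_tensors[OF mem]]
    by (simp add: entry_svd_product[OF mem] eq U S V del: entry_mk_tensor)
  ultimately show ?thesis
    unfolding is_E_SVD_def using mem(2) by blast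
qed

section \<open>Singular values and squared norms\<close>

lemma sum_square_single_support:
  fixes f :: "'a \<Rightarrow> real"
  assumes "finite A" "\<And>x y. \<lbrakk>x \<in> A; y \<in> A; f x \<noteq> 0; f y \<noteq> 0\<rbrakk> \<Longrightarrow> x = y"
  shows "(\<Sum>x\<in>A. f x)\<^sup>2 = (\<Sum>x\<in>A. (f x)\<^sup>2)"
proof (cases "\<exists>x\<in>A. f x \<noteq> 0")
  case True
  then obtain x where x: "x \<in> A" "f x \<noteq> 0" by blast
  then have "\<forall>y\<in>A - {x}. f y = 0" using assms(2) by blast
  then show ?thesis using x assms(1) by (simp add: sum.remove)
qed simp

text \<open>Replaces the definite description by a row norm of \<open>S\<close>, which also covers
  rows without a nonzero entry.\<close>

lemma singular_value_square:
  assumes "diagonal_like Is Ks S" "i \<in> idx Is"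
  shows "(singular_value Ks S i)\<^sup>2 = (\<Sum>k\<in>idx Ks. (entry S (i @ k))\<^sup>2)"
proof (cases "\<exists>k\<in>idx Ks. entry S (i @ k) \<noteq> 0")
  case True
  then obtain k where k: "k \<in> idx Ks" "entry S (i @ k) \<noteq> 0" by blast
  then have k': "k' = k" if "k' \<in> idx Ks" "entry S (i @ k') \<noteq> 0" for k'
    using assms that unfolding diagonal_like_def by blast
  then have "(THE k. k \<in> idx Ks \<and> entry S (i @ k) \<noteq> 0) = k"
    using k by blast
  then have "singular_value Ks S i = entry S (i @ k)"
    using True by (simp add: singular_value_def)
  moreover have "\<forall>k'\<in>idx Ks - {k}. entry S (i @ k') = 0" using k' by blast
  ultimately show ?thesis using k by (simp add: sum.remove)
next
  case False
  then show ?thesis by (simp add: singular_value_def)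
qed

text \<open>Nonnegativity makes the order of the singular values agree with that of their
  squares.\<close>

lemma singular_value_nonneg:
  assumes "diagonal_like Is Ks S" "\<forall>l\<in>idx (Is @ Ks). 0 \<le> entry S l" "i \<in> idx Is"
  shows "0 \<le> singular_value Ks S i"
proof (cases "\<exists>k\<in>idx Ks. entry S (i @ k) \<noteq> 0")
  case True
  then have "\<exists>!k. k \<in> idx Ks \<and> entry S (i @ k) \<noteq> 0"
    using assms(1,3) unfolding diagonal_like_def by blast
  from theI'[OF this] show ?thesis
    using True assms(2,3) by (simp add: singular_value_def append_mem_idx)
qed (simp add: singular_value_def)

text \<open>The row vector \<open>x\<^sup>T A\<close> equals
  \<open>(x\<^sup>T U) S V\<^sup>T\<close>. The factor \<open>V\<^sup>T\<close> preserves the norm,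
  and the diagonal-like \<open>S\<close> leaves no cross terms between coordinates of
  \<open>x\<^sup>T U\<close>.\<close>

lemma sum_square_E_SVD:
  assumes svd: "is_E_SVD Is Ks A U S V"
  shows "(\<Sum>k\<in>idx Ks. (\<Sum>i\<in>idx Is. x i * entry A (i @ k))\<^sup>2) =
    (\<Sum>a\<in>idx Is. (singular_value Ks S a)\<^sup>2 * (\<Sum>i\<in>idx Is. x i * entry U (i @ a))\<^sup>2)"
proof -
  have mem: "U \<in> tensors (Is @ Is)" "S \<in> tensors (Is @ Ks)" "V \<in> tensors (Ks @ Ks)"
    and diag: "diagonal_like Is Ks S"
    and A: "A = U \<star>\<^bsub>length Is\<^esub> S \<star>\<^bsub>length Ks\<^esub> tensor_transpose (length Ks) V"
    using svd by (auto simp: is_E_SVD_def unitary_def)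
  have V: "orthogonal_family (idx Ks) (idx Ks) (\<lambda>b k. entry V (k @ b))"
    using svd unitary_iff_orthogonal_family[OF mem(3)] by (simp add: is_E_SVD_def)
  \<comment> \<open>Parseval is needed for the rows of \<open>V\<close>; with equal index sets,
    transposing just exchanges the two defining relations.\<close>
  then have V': "orthogonal_family (idx Ks) (idx Ks) (\<lambda>k b. entry V (k @ b))"
    unfolding orthogonal_family_def by blast
  define y where "y a = (\<Sum>i\<in>idx Is. x i * entry U (i @ a))" for a
  define c where "c b = (\<Sum>a\<in>idx Is. y a * entry S (a @ b))" for b
  have "(\<Sum>i\<in>idx Is. x i * entry A (i @ k)) = (\<Sum>b\<in>idx Ks. c b * entry V (k @ b))"
    if "k \<in> idx Ks" for k
  proof -
    have "(\<Sum>i\<in>idx Is. x i * entry A (i @ k)) =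
        (\<Sum>i\<in>idx Is. \<Sum>a\<in>idx Is. \<Sum>b\<in>idx Ks. x i * entry U (i @ a) * entry S (a @ b) * entry V (k @ b))"
      unfolding A using that by (simp add: entry_svd_product[OF mem] sum_distrib_left mult.assoc)
    also have "\<dots> = (\<Sum>a\<in>idx Is. \<Sum>b\<in>idx Ks. y a * entry S (a @ b) * entry V (k @ b))"
      unfolding y_def sum_distrib_right
      by (subst sum.swap) (intro sum.cong refl sum.swap)
    also have "\<dots> = (\<Sum>b\<in>idx Ks. c b * entry V (k @ b))"
      unfolding c_def sum_distrib_right by (rule sum.swap)
    finally show ?thesis .
  qed
  then have "(\<Sum>k\<in>idx Ks. (\<Sum>i\<in>idx Is. x i * entry A (i @ k))\<^sup>2) =
      (\<Sum>k\<in>idx Ks. (\<Sum>b\<in>idx Ks. c b * entry V (k @ b))\<^sup>2)"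
    by simp
  also have "\<dots> = (\<Sum>b\<in>idx Ks. (c b)\<^sup>2)"
    by (rule parseval_identity[OF V' finite_idx])
  \<comment> \<open>Each column of \<open>S\<close> has at most one nonzero entry, so its sum may be
    squared termwise.\<close>
  also have "\<dots> = (\<Sum>b\<in>idx Ks. \<Sum>a\<in>idx Is. (y a * entry S (a @ b))\<^sup>2)"
    unfolding c_def using diag
    by (intro sum.cong refl sum_square_single_support) (auto simp: diagonal_like_def)
  also have "\<dots> = (\<Sum>a\<in>idx Is. (y a)\<^sup>2 * (\<Sum>b\<in>idx Ks. (entry S (a @ b))\<^sup>2))"
    by (subst sum.swap) (simp add: power_mult_distrib sum_distrib_left)
  also have "\<dots> = (\<Sum>a\<in>idx Is. (singular_value Ks S a)\<^sup>2 * (y a)\<^sup>2)"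
    by (simp add: singular_value_square[OF diag] mult.commute)
  finally show ?thesis unfolding y_def .
qed

section \<open>Principal component analysis\<close>

lemma pca_objective_eq:
  assumes Y: "Y \<in> tensors (ds @ [n])"
  shows "pca_objective Y =
    (\<Sum>i<n. \<Sum>l\<in>idx ds. (entry Y (l @ [i]) - (\<Sum>j<n. entry Y (l @ [j])) / n)\<^sup>2)"
proof -
  have "last (dims Y) = n" using Y by (simp add: tensors_def)
  moreover have "(frobenius_norm (frontal_slice Y i - mean_slice Y))\<^sup>2 =
      (\<Sum>l\<in>idx ds. (entry Y (l @ [i]) - (\<Sum>j<n. entry Y (l @ [j])) / n)\<^sup>2)" for i
    using Y by (simp add: frobenius_norm_def sum_nonneg entry_minus dims_frontal_slice
        entry_frontal_slice entry_mean_slice)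
  ultimately show ?thesis by (simp add: pca_objective_def)
qed

text \<open>Projection is linear, so the mean of the projected data is the projected mean. Thus
  centering can be moved from \<open>Y\<close> to the data, and each slice of \<open>P\<close>
  contributes one squared norm.\<close>

lemma pca_objective_projection:
  assumes P: "P \<in> tensors (Is @ [d])" and X: "X \<in> tensors (Is @ [n])"
    and B: "\<And>l i. l \<in> idx Is \<Longrightarrow> i < n \<Longrightarrow>
      entry B (l @ [i]) = entry X (l @ [i]) - (\<Sum>j<n. entry X (l @ [j])) / n"
  shows "pca_objective (tensor_transpose (length Is) P \<star>\<^bsub>length Is\<^esub> X) =
    (\<Sum>k<d. \<Sum>i\<in>idx [n]. (\<Sum>l\<in>idx Is. entry P (l @ [k]) * entry B (l @ i))\<^sup>2)"
proof -
  let ?Y = "tensor_transpose (length Is) P \<star>\<^bsub>length Is\<^esub> X"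
  note T = transpose_in_tensors[OF P]
  have Y: "?Y \<in> tensors ([d] @ [n])"
    using einstein_in_tensors[OF T X] .
  have entry_Y: "entry ?Y ([k] @ [i]) = (\<Sum>l\<in>idx Is. entry P (l @ [k]) * entry X (l @ [i]))"
    if "k < d" "i < n" for k i
    using that entry_einstein[OF T X, of "[k]" "[i]"]
    by (simp add: idx_singleton entry_transpose[OF P] del: append_Cons append_Nil)
  have "entry ?Y ([k] @ [i]) - (\<Sum>j<n. entry ?Y ([k] @ [j])) / n =
      (\<Sum>l\<in>idx Is. entry P (l @ [k]) * entry B (l @ [i]))" if "k < d" "i < n" for k i
  proof -
    have "(\<Sum>j<n. entry ?Y ([k] @ [j])) / n =
        (\<Sum>l\<in>idx Is. entry P (l @ [k]) * ((\<Sum>j<n. entry X (l @ [j])) / n))"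
      using that by (simp add: entry_Y sum_distrib_left sum_divide_distrib del: append_Cons append_Nil)
        (rule sum.swap)
    then show ?thesis
      using that by (simp add: entry_Y B right_diff_distrib sum_subtractf del: append_Cons append_Nil)
  qed
  then have "pca_objective ?Y = (\<Sum>i<n. \<Sum>k<d. (\<Sum>l\<in>idx Is. entry P (l @ [k]) * entry B (l @ [i]))\<^sup>2)"
    unfolding pca_objective_eq[OF Y] sum_idx_singleton by (intro sum.cong refl) simp
  then show ?thesis
    unfolding sum_idx_singleton by (subst sum.swap)
qed

text \<open>Feasibility is orthonormality of the frontal slices, without completeness in general;
  this is the setting of Bessel's inequality.\<close>

lemma pca_feasible_iff:
  assumes P: "P \<in> tensors (Is @ [d])"
  shows "P \<in> pca_feasible Is d \<longleftrightarrow>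
    (\<forall>k<d. \<forall>l<d. (\<Sum>i\<in>idx Is. entry P (i @ [k]) * entry P (i @ [l])) = of_bool (k = l))"
proof -
  note T = transpose_in_tensors[OF P]
  have "P \<in> pca_feasible Is d \<longleftrightarrow> (\<forall>k\<in>idx [d]. \<forall>l\<in>idx [d].
      (\<Sum>i\<in>idx Is. entry P (i @ k) * entry P (i @ l)) = of_bool (k = l))"
    using P by (simp add: pca_feasible_def tensor_eq_iff[OF einstein_in_tensors[OF T P] id_tensor_in_tensors]
        entry_einstein[OF T P] entry_id_tensor entry_transpose[OF P])
  then show ?thesis by (simp add: idx_singleton) auto
qed

lemma largest_left_singular_tensors_solve_pca:
  assumes X: "X \<in> tensors (Is @ [n])"
    and B: "\<And>l i. l \<in> idx Is \<Longrightarrow> i < n \<Longrightarrow>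
      entry B (l @ [i]) = entry X (l @ [i]) - (\<Sum>j<n. entry X (l @ [j])) / n"
    and P: "largest_left_singular_tensors Is [n] B d P"
  shows "pca_solution Is d X P"
proof -
  obtain U S V \<iota> where svd: "is_E_SVD Is [n] B U S V"
    and \<iota>: "inj_on \<iota> {..<d}" "\<iota> ` {..<d} \<subseteq> idx Is"
    and largest: "\<And>i i'. i \<in> \<iota> ` {..<d} \<Longrightarrow> i' \<in> idx Is - \<iota> ` {..<d} \<Longrightarrow>
      singular_value [n] S i' \<le> singular_value [n] S i"
    and slice: "\<And>k. k < d \<Longrightarrow> frontal_slice P k = slice U (\<iota> k)"
    and mem: "P \<in> tensors (Is @ [d])"
    using P unfolding largest_left_singular_tensors_def by blast
  have U: "U \<in> tensors (Is @ Is)" and diag: "diagonal_like Is [n] S"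
    and pos: "\<forall>l\<in>idx (Is @ [n]). 0 \<le> entry S l"
    using svd by (auto simp: is_E_SVD_def unitary_def)
  have orth: "orthogonal_family (idx Is) (idx Is) (\<lambda>a i. entry U (i @ a))"
    using svd unitary_iff_orthogonal_family[OF U] by (simp add: is_E_SVD_def)
  have \<iota>_mem: "\<iota> k \<in> idx Is" if "k < d" for k using \<iota>(2) that by blast
  have \<iota>_eq: "\<iota> k = \<iota> l \<longleftrightarrow> k = l" if "k < d" "l < d" for k l
    using \<iota>(1) that by (auto simp: inj_on_def)
  have entry_P: "entry P (i @ [k]) = entry U (i @ \<iota> k)" if "k < d" "i \<in> idx Is" for i k
    using slice[OF that(1)] entry_frontal_slice[OF mem that(2), of k]
      entry_slice[OF U _ that(2), of "\<iota> k"] \<iota>_mem[OF that(1)] by (simp add: idx_length)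
  have P_feasible: "P \<in> pca_feasible Is d"
    unfolding pca_feasible_iff[OF mem] using orth
    by (simp add: entry_P \<iota>_mem \<iota>_eq orthogonal_family_def)
  define s where "s a = (singular_value [n] S a)\<^sup>2" for a
  have objective: "pca_objective (tensor_transpose (length Is) P' \<star>\<^bsub>length Is\<^esub> X) =
      (\<Sum>k<d. \<Sum>a\<in>idx Is. s a * (\<Sum>i\<in>idx Is. entry P' (i @ [k]) * entry U (i @ a))\<^sup>2)"
    if "P' \<in> tensors (Is @ [d])" for P'
  proof -
    have "pca_objective (tensor_transpose (length Is) P' \<star>\<^bsub>length Is\<^esub> X) =
        (\<Sum>k<d. \<Sum>i\<in>idx [n]. (\<Sum>l\<in>idx Is. entry P' (l @ [k]) * entry B (l @ i))\<^sup>2)"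
      using that X B by (rule pca_objective_projection)
    then show ?thesis unfolding sum_square_E_SVD[OF svd] s_def .
  qed
  have "pca_objective (tensor_transpose (length Is) P' \<star>\<^bsub>length Is\<^esub> X) \<le> (\<Sum>a\<in>\<iota> ` {..<d}. s a)"
    if P': "P' \<in> pca_feasible Is d" for P'
  proof -
    have mem': "P' \<in> tensors (Is @ [d])" using P' by (simp add: pca_feasible_def)
    \<comment> \<open>The ranking is by singular values, while the objective involves their
      squares.\<close>
    have "s i' \<le> s i" if "i \<in> \<iota> ` {..<d}" "i' \<in> idx Is - \<iota> ` {..<d}" for i i'
      unfolding s_def using largest[OF that] that singular_value_nonneg[OF diag pos]
      by (intro power_mono) auto
    then show ?thesis
      unfolding objective[OF mem'] using P' \<iota> orth unfolding pca_feasible_iff[OF mem']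
      by (intro ky_fan_inequality) (auto simp: card_image)
  qed
  moreover have "pca_objective (tensor_transpose (length Is) P \<star>\<^bsub>length Is\<^esub> X) = (\<Sum>a\<in>\<iota> ` {..<d}. s a)"
  proof -
    \<comment> \<open>The slices of \<open>P\<close> are themselves slices of \<open>U\<close>, so
      exactly the selected squares survive and the bound is attained.\<close>
    have "(\<Sum>i\<in>idx Is. entry P (i @ [k]) * entry U (i @ a)) = of_bool (\<iota> k = a)"
      if "k < d" "a \<in> idx Is" for k a
      using that orth by (simp add: entry_P \<iota>_mem orthogonal_family_def)
    then have "pca_objective (tensor_transpose (length Is) P \<star>\<^bsub>length Is\<^esub> X) =
        (\<Sum>k<d. \<Sum>a\<in>idx Is. if \<iota> k = a then s a else 0)"
      unfolding objective[OF mem] by (intro sum.cong refl) simp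
    also have "\<dots> = (\<Sum>k<d. s (\<iota> k))"
      by (simp add: \<iota>_mem)
    finally show ?thesis
      using \<iota>(1) by (simp add: sum.reindex)
  qed
  ultimately show ?thesis
    unfolding pca_solution_def using P_feasible by simp
qed

lemma exists_largest_left_singular_tensors:
  assumes A: "A \<in> tensors (Is @ Ks)" and d: "d \<le> prod_list Is"
  shows "\<exists>P. largest_left_singular_tensors Is Ks A d P"
proof -
  obtain U S V where svd: "is_E_SVD Is Ks A U S V"
    using exists_E_SVD[OF A] by blast
  obtain \<iota> where \<iota>: "inj_on \<iota> {..<d}" "\<iota> ` {..<d} \<subseteq> idx Is"
    and largest: "\<forall>i\<in>\<iota> ` {..<d}. \<forall>i'\<in>idx Is - \<iota> ` {..<d}. singular_value Ks S i' \<le> singular_value Ks S i"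
    using exists_enumeration_of_largest[OF finite_idx, of d Is "singular_value Ks S"] d
    by (auto simp: card_idx)
  have U: "U \<in> tensors (Is @ Is)" using svd by (simp add: is_E_SVD_def unitary_def)
  \<comment> \<open>The last index \<open>k\<close> of \<open>P\<close> is translated into the
    multi-index \<open>\<iota> k\<close> of the chosen slice of \<open>U\<close>.\<close>
  let ?P = "mk_tensor (Is @ [d]) (\<lambda>l. entry U (take (length Is) l @ \<iota> (l ! length Is)))"
  have P: "?P \<in> tensors (Is @ [d])" by (simp add: tensors_def)
  have "frontal_slice ?P k = slice U (\<iota> k)" if k: "k < d" for k
  proof (rule tensor_eqI)
    have len: "length (\<iota> k) = length Is" using \<iota>(2) k by (auto simp: idx_length)
    show "dims (frontal_slice ?P k) = dims (slice U (\<iota> k))"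
      unfolding dims_frontal_slice[OF P] dims_slice[OF U len] ..
    fix l assume "l \<in> idx (dims (frontal_slice ?P k))"
    then have l: "l \<in> idx Is" unfolding dims_frontal_slice[OF P] .
    have "l @ [k] \<in> idx (Is @ [d])"
      using l k by (intro append_mem_idx) (auto simp: idx_singleton)
    then show "entry (frontal_slice ?P k) l = entry (slice U (\<iota> k)) l"
      unfolding entry_frontal_slice[OF P l] entry_slice[OF U len l] using l
      by (simp add: idx_length nth_append)
  qed
  then show ?thesis
    unfolding largest_left_singular_tensors_def using svd \<iota> largest P by blast
qed

section \<open>The centering matrix\<close>

lemma centering_matrix_in_tensors: "centering_matrix n \<in> tensors ([n] @ [n])"
  by (simp add: centering_matrix_def tensors_def id_tensor_def)

lemma entry_centering_matrix:
  assumes "i < n" "k < n"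
  shows "entry (centering_matrix n) [i, k] = of_bool (i = k) - 1 / n"
proof -
  have o: "ones n \<in> tensors ([n] @ [1])" by (simp add: ones_def tensors_def)
  \<comment> \<open>The contracted mode of the outer product has length 1, with \<open>[0]\<close>
    as its only index.\<close>
  have i: "[i] \<in> idx [n]" "[k] \<in> idx [n]" and z: "[0] \<in> idx [1]"
    using assms by (auto simp: idx_singleton)
  have one: "entry (ones n) ([j] @ [0]) = 1" if "[j] \<in> idx [n]" for j
    using append_mem_idx[OF that z] by (simp add: ones_def)
  have "entry (ones n \<star>\<^bsub>1\<^esub> tensor_transpose 1 (ones n)) ([i] @ [k]) = 1"
    using entry_einstein[OF o transpose_in_tensors[OF o] i] entry_transpose[OF o i(2) z] one i
    by (simp add: sum_idx_singleton)
  moreover have "entry (id_tensor [n]) ([i] @ [k]) = of_bool (i = k)"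
    using entry_id_tensor[OF i] by simp
  moreover have "[i] @ [k] \<in> idx (dims (id_tensor [n]))"
    using append_mem_idx[OF i] by (simp add: id_tensor_def)
  ultimately show ?thesis
    by (simp add: centering_matrix_def entry_minus entry_scaleR)
qed

text \<open>In the product with \<open>H\<close>, the identity part returns the entry of
  \<open>X\<close> and the constant part \<open>-1/n\<close> subtracts the mean over the
  samples.\<close>

lemma mode_product_centering_matrix:
  assumes X: "X \<in> tensors (Is @ [n])"
    and B: "B \<in> tensors (Is @ [n])" "\<And>l i. l \<in> idx Is \<Longrightarrow> i < n \<Longrightarrow>
      entry B (l @ [i]) = entry X (l @ [i]) - (\<Sum>j<n. entry X (l @ [j])) / n"
  shows "mode_product X (length Is + 1) (centering_matrix n) = B"
proof -
  let ?M = "mode_product X (length Is + 1) (centering_matrix n)"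
  have dims: "dims X = Is @ [n]" "dims (centering_matrix n) = [n, n]"
    using X centering_matrix_in_tensors[of n] by (simp_all add: tensors_def)
  have "?M \<in> tensors (Is @ [n])"
    by (simp add: mode_product_def tensors_def dims)
  moreover have "entry ?M (l @ k) = entry B (l @ k)" if l: "l \<in> idx Is" and k: "k \<in> idx [n]" for l k
  proof -
    obtain i where i: "k = [i]" "i < n" using k by (auto simp: idx_singleton)
    \<comment> \<open>Modes are counted from 1, so mode \<open>length Is + 1\<close> is list
      position \<open>length Is\<close>, that of \<open>i\<close>.\<close>
    have "entry ?M (l @ [i]) = (\<Sum>j<n. entry (centering_matrix n) [i, j] * entry X (l @ [j]))"
      using append_mem_idx[OF l k] idx_length[OF l] i
      by (simp add: mode_product_def dims nth_append list_update_append)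
    also have "\<dots> = (\<Sum>j<n. (if i = j then entry X (l @ [j]) else 0) - entry X (l @ [j]) / n)"
      using i by (intro sum.cong refl) (simp add: entry_centering_matrix left_diff_distrib)
    also have "\<dots> = entry B (l @ [i])"
      using i l by (simp add: B sum_subtractf sum_divide_distrib)
    finally show ?thesis unfolding i .
  qed
  ultimately show ?thesis
    using tensor_eq_iff[OF _ B(1)] by blast
qed

text \<open>The existence claim keeps the final implication from being vacuous; the latter covers
  every E-SVD, every way of breaking ties and every order of the slices.\<close>

theorem mainTheorem1:
  fixes Is :: "nat list" and n d :: nat and X Q :: tensor
  assumes "Is \<noteq> []" and "1 \<le> n" and "1 \<le> d" and "d \<le> prod_list Is"
    and "X \<in> tensors (Is @ [n])"
    and "Q \<in> tensors (Is @ [n])"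
    and "\<forall>i<n. frontal_slice Q i = mean_slice X"
  shows "mode_product X (length Is + 1) (centering_matrix n) = X - Q
    \<and> (\<exists>P. largest_left_singular_tensors Is [n] (X - Q) d P)
    \<and> (\<forall>P. largest_left_singular_tensors Is [n] (X - Q) d P \<longrightarrow> pca_solution Is d X P)"
proof -
  have mem: "X - Q \<in> tensors (Is @ [n])"
    using assms(5) by (simp add: tensors_def)
  \<comment> \<open>The condition on the slices of \<open>Q\<close> becomes the entrywise centering
    formula that the lemmas on the objective and on \<open>H\<close> expect.\<close>
  have entry: "entry (X - Q) (l @ [i]) = entry X (l @ [i]) - (\<Sum>j<n. entry X (l @ [j])) / n"
    if "l \<in> idx Is" "i < n" for l i
  proof -
    have "l @ [i] \<in> idx (dims X)"
      using assms(5) that append_mem_idx[of l Is "[i]" "[n]"] by (simp add: tensors_def idx_singleton)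
    moreover have "entry Q (l @ [i]) = entry (mean_slice X) l"
      using entry_frontal_slice[OF assms(6) that(1), of i] assms(7) that(2) by simp
    ultimately show ?thesis
      by (simp add: entry_minus entry_mean_slice[OF assms(5) that(1)])
  qed
  show ?thesis
    using mode_product_centering_matrix[OF assms(5) mem entry]
      exists_largest_left_singular_tensors[OF mem assms(4)]
      largest_left_singular_tensors_solve_pca[OF assms(5) entry] by blast
qed

end
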